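(* Let $\mathbf{A}(x,\lambda)$ be a $3\times3$ matrix-valued function of $x\in\mathbb{R}$ and $\lambda\in\mathbb{C}$, $T$-periodic in $x$ for some $T>0$, satisfying (A1) and (A2) (stated in the context), with $\operatorname{tr}(\mathbf{A}(x,\lambda))=0$ for all $x\in\mathbb{R}$ and $\lambda\in\mathbb{C}$. Let $\mathbf{M}(\lambda)$ be the monodromy matrix of $\mathbf{v}_x=\mathbf{A}(x,\lambda)\mathbf{v}$. Then for $\lambda\in i\mathbb{R}$, $\mathbf{M}(\lambda)$ has either one or three eigenvalues on the unit circle, counted by algebraic multiplicity. For $\lambda\in i\mathbb{R}$ let $f(\lambda)=\operatorname{tr}(\mathbf{M}(\lambda))=f_1(\lambda)+if_2(\lambda)$ with $f_1,f_2$ real, and let $$\Delta_3(\lambda)=|f(\lambda)|^4-4f(\lambda)^3-4\overline{f(\lambda)}^3+18|f(\lambda)|^2-27=\big((f_1^2+f_2^2)^2-8(f_1^3-3f_1f_2^2)+18(f_1^2+f_2^2)-27\big)(\lambda).$$ Then, for $\lambda\in i\mathbb{R}$: (1) If $\Delta_3(\lambda)<0$ then $\mathbf{M}(\lambda)$ has three distinct eigenvalues on the unit circle, implying that $\lambda$ belongs to the $L^2(\mathbb{R})$ essential spectrum of $\lambda v=\mathcal{J}\mathcal{L}v$ with algebraic multiplicity three. (2) If $\Delta_3(\lambda)>0$ then $\mathbf{M}(\lambda)$ has three eigenvalues: one on the unit circle, one inside the unit circle, and one outside the unit circle; the latter two have the same argument. (3) If $\Delta_3(\lambda)=0$ then $\mathbf{M}(\lambda)$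 has three eigenvalues on the unit circle, counted with algebraic multiplicity, and at least two of them coincide. Alternatively, let $\Gamma=\{2e^{i\theta}+e^{-2i\theta}\in\mathbb{C}:\theta\in[-\pi,\pi]\}$ (the deltoid curve). Then, for $\lambda\in i\mathbb{R}$: (1') If $f(\lambda)$ lies inside $\Gamma$, i.e. in the connected component of $\mathbb{C}\setminus\Gamma$ containing $0$, then $\mathbf{M}(\lambda)$ has three distinct eigenvalues on the unit circle. (2') If $f(\lambda)$ lies outside $\Gamma$, i.e. in the unbounded connected component of $\mathbb{C}\setminus\Gamma$, then $\mathbf{M}(\lambda)$ has three eigenvalues: one on, one inside, and one outside the unit circle. (3') If $f(\lambda)$ lies on $\Gamma$ then $\mathbf{M}(\lambda)$ has three eigenvalues on the unit circle (counted with multiplicity) and at least one eigenvalue has higher multiplicity. Specifically, one eigenvalue has algebraic multiplicity one and another has algebraic multiplicity two, unless $f(\lambda)$ is one of the cusps $3$, $3e^{2\pi i/3}$, $3e^{4\pi i/3}$ of $\Gamma$, in which cases $1$, $e^{2\pi i/3}$, $e^{4\pi i/3}$, respectively, is an eigenvalue with algebraic multiplicity three.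
   Context: Assumptions. (A1) $\mathbf{A}(x,\lambda)$ is real for $\lambda\in\mathbb{R}$. (A2) $\mathbf{A}^\top(x,\lambda)\mathbf{B}(\lambda)=-\mathbf{B}(\lambda)\mathbf{A}(x,-\lambda)$ for some matrix $\mathbf{B}(\lambda)$, independent of $x$, and nonsingular for all $\lambda\in\mathbb{C}$ except at most finitely many values of $\lambda$ ($\top$ is the non-conjugated transpose). Regularity: $\mathbf{A}$ is continuous in $(x,\lambda)$ and, for each $x$, entire in $\lambda$. Monodromy matrix: $\mathbf{M}(\lambda)=\mathbf{V}(T,\lambda)$, where $\mathbf{V}_x=\mathbf{A}(x,\lambda)\mathbf{V}$ and $\mathbf{V}(0,\lambda)=\mathbf{I}$, the identity matrix. Spectral problem: $\mathbf{v}_x=\mathbf{A}(x,\lambda)\mathbf{v}$ is the first-order reformulation of a spectral problem $\lambda v=\mathcal{J}\mathcal{L}v$, $\lambda\in\mathbb{C}$, where $\mathcal{J}$ represents a symplectic form, $\mathcal{L}$ is a linear self-adjoint operator, and $\mathcal{J}\mathcal{L}$ has $T$-periodic coefficients in $x$. By Floquet theory $\lambda$ belongs to the $L^2(\mathbb{R})$ essential spectrum iff $\mathbf{M}(\lambda)$ has an eigenvalue on the unit circle; when $\mathbf{M}(\lambda)$ has exactly $m$ eigenvalues on the unit circle, all simple, $\lambda$ is said to belong to the essential spectrum with algebraic multiplicity $m$. *)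

theory Defs
  imports "HOL-Analysis.Analysis" "HOL-Computational_Algebra.Polynomial"
begin

section \<open>Eigenvalues with algebraic multiplicity\<close>

definition eigenvalues :: "complex^'n^'n \<Rightarrow> complex set" where
  "eigenvalues M = {\<mu>. \<exists>v. v \<noteq> 0 \<and> M *v v = \<mu> *s v}"

text \<open>The characteristic polynomial \<open>det (X I - M)\<close>, a determinant over the ring of polynomials.\<close>

definition char_polynomial :: "complex^'n^'n \<Rightarrow> complex poly" where
  "char_polynomial M = det (\<chi> i j. [: - (M $ i $ j), (if i = j then 1 else 0) :])"

definition alg_mult :: "complex^'n^'n \<Rightarrow> complex \<Rightarrow> nat" where
  "alg_mult M \<mu> = order \<mu> (char_polynomial M)"

definition circle_eigenvalues :: "complex^'n^'n \<Rightarrow> complex set" where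
  "circle_eigenvalues M = {\<mu> \<in> eigenvalues M. cmod \<mu> = 1}"

definition circle_count :: "complex^'n^'n \<Rightarrow> nat" where
  "circle_count M = (\<Sum>\<mu>\<in>circle_eigenvalues M. alg_mult M \<mu>)"


section \<open>The periodic first-order system\<close>

definition admissible_coefficients :: "real \<Rightarrow> (real \<Rightarrow> complex \<Rightarrow> complex^'n^'n) \<Rightarrow> bool" where
  "admissible_coefficients T A \<longleftrightarrow>
     continuous_on UNIV (\<lambda>(x, lam). A x lam) \<and>
     (\<forall>x i j. (\<lambda>lam. A x lam $ i $ j) holomorphic_on UNIV) \<and>
     (\<forall>x lam. A (x + T) lam = A x lam)"

definition real_on_real_axis :: "(real \<Rightarrow> complex \<Rightarrow> complex^'n^'n) \<Rightarrow> bool" where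
  "real_on_real_axis A \<longleftrightarrow> (\<forall>x (r::real) i j. A x (of_real r) $ i $ j \<in> \<real>)"

definition hamiltonian_symmetry :: "(real \<Rightarrow> complex \<Rightarrow> complex^'n^'n) \<Rightarrow> bool" where
  "hamiltonian_symmetry A \<longleftrightarrow>
     (\<exists>B. (\<forall>x lam. transpose (A x lam) ** B lam = - (B lam ** A x (- lam))) \<and>
          finite {lam. \<not> invertible (B lam)})"

definition fundamental_solution ::
    "(real \<Rightarrow> complex \<Rightarrow> complex^'n^'n) \<Rightarrow> (real \<Rightarrow> complex \<Rightarrow> complex^'n^'n) \<Rightarrow> bool" where
  "fundamental_solution A V \<longleftrightarrow>
     (\<forall>lam. V 0 lam = mat 1 \<and>
       (\<forall>x. ((\<lambda>y. V y lam) has_vector_derivative A x lam ** V x lam) (at x)))"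


section \<open>Unbounded operators on square-integrable functions\<close>

text \<open>Elements of \<open>L\<^sup>2(\<real>)\<close> are represented by Borel functions, with equality almost everywhere
  made explicit. An operator is given by its graph, a set of pairs (argument, value).\<close>

definition L2 :: "(real \<Rightarrow> complex^'n) set" where
  "L2 = {v \<in> borel_measurable lborel. integrable lborel (\<lambda>x. (norm (v x))\<^sup>2)}"

definition ae_eq :: "(real \<Rightarrow> complex^'n) \<Rightarrow> (real \<Rightarrow> complex^'n) \<Rightarrow> bool" where
  "ae_eq u v \<longleftrightarrow> (AE x in lborel. u x = v x)"

definition L2_inner :: "(real \<Rightarrow> complex^'n) \<Rightarrow> (real \<Rightarrow> complex^'n) \<Rightarrow> complex" where
  "L2_inner u v = (LINT x|lborel. (\<Sum>i\<in>UNIV. u x $ i * cnj (v x $ i)))"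

definition L2_adjoint :: "(real \<Rightarrow> complex^'n) rel \<Rightarrow> (real \<Rightarrow> complex^'n) rel" where
  "L2_adjoint G = {(u, z). u \<in> L2 \<and> z \<in> L2 \<and> (\<forall>(v, w)\<in>G. L2_inner w u = L2_inner v z)}"

definition ae_functional :: "(real \<Rightarrow> complex^'n) rel \<Rightarrow> bool" where
  "ae_functional G \<longleftrightarrow> (\<forall>(v, w)\<in>G. ae_eq v (\<lambda>_. 0) \<longrightarrow> ae_eq w (\<lambda>_. 0))"

definition L2_kernel :: "(real \<Rightarrow> complex^'n) rel \<Rightarrow> (real \<Rightarrow> complex^'n) set" where
  "L2_kernel G = {v \<in> L2. \<exists>w. (v, w) \<in> G \<and> ae_eq w (\<lambda>_. 0)}"

definition L2_range :: "(real \<Rightarrow> complex^'n) rel \<Rightarrow> (real \<Rightarrow> complex^'n) set" where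
  "L2_range G = {g \<in> L2. \<exists>v w. (v, w) \<in> G \<and> ae_eq w g}"

definition L2_closed :: "(real \<Rightarrow> complex^'n) set \<Rightarrow> bool" where
  "L2_closed X \<longleftrightarrow>
     (\<forall>w g. (\<forall>n::nat. w n \<in> X) \<and> g \<in> L2 \<and>
        (\<lambda>n. LINT x|lborel. (norm (w n x - g x))\<^sup>2) \<longlonglongrightarrow> 0 \<longrightarrow> g \<in> X)"

text \<open>\<open>X\<close> has finite complex dimension modulo the subspace \<open>N\<close>.\<close>

definition finite_dim_mod :: "(real \<Rightarrow> complex^'n) set \<Rightarrow> (real \<Rightarrow> complex^'n) set \<Rightarrow> bool" where
  "finite_dim_mod N X \<longleftrightarrow>
     (\<exists>S. finite S \<and> S \<subseteq> L2 \<and>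
       (\<forall>g\<in>X. \<exists>n\<in>N. \<exists>c :: (real \<Rightarrow> complex^'n) \<Rightarrow> complex.
          ae_eq g (\<lambda>x. n x + (\<Sum>s\<in>S. c s *s s x))))"

definition L2_fredholm :: "(real \<Rightarrow> complex^'n) rel \<Rightarrow> bool" where
  "L2_fredholm G \<longleftrightarrow>
     finite_dim_mod {\<lambda>_. 0} (L2_kernel G) \<and>
     L2_closed (L2_range G) \<and>
     finite_dim_mod (L2_range G) L2"

text \<open>The graph of \<open>\<lambda> - P\<close>.\<close>

definition shifted_graph :: "(real \<Rightarrow> complex^'n) rel \<Rightarrow> complex \<Rightarrow> (real \<Rightarrow> complex^'n) rel" where
  "shifted_graph P lam = {(v, \<lambda>x. lam *s v x - w x) | v w. (v, w) \<in> P}"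

text \<open>This set is contained in the variant of the essential spectrum where \<open>\<lambda> - P\<close> is also required to have index zero.\<close>

definition essential_spectrum :: "(real \<Rightarrow> complex^'n) rel \<Rightarrow> complex set" where
  "essential_spectrum P = {lam. \<not> L2_fredholm (shifted_graph P lam)}"


section \<open>The spectral problem and its first-order reformulation\<close>

text \<open>\<open>L\<close> is self-adjoint; \<open>J\<close> is skew-adjoint and injective, so that it represents a symplectic
  (that is, skew and nondegenerate) form. The product \<open>J L\<close> has the graph \<open>L O J\<close>. Periodicity
  of its coefficients is expressed as invariance of the graph under translation by \<open>T\<close>.
  The adjoint relation is single-valued exactly if the domain is dense, so \<open>ae_functional\<close> together
  with \<open>L2_adjoint L = L\<close> also encodes the density of the domain; likewise for \<open>J\<close>.\<close>

definition hamiltonian_problem ::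
    "real \<Rightarrow> (real \<Rightarrow> complex^'n) rel \<Rightarrow> (real \<Rightarrow> complex^'n) rel \<Rightarrow> bool" where
  "hamiltonian_problem T J L \<longleftrightarrow>
     L2_adjoint L = L \<and> ae_functional L \<and>
     L2_adjoint J = {(u, z). (u, \<lambda>x. - z x) \<in> J} \<and> ae_functional J \<and> ae_functional (J\<inverse>) \<and>
     (\<forall>v w. (v, w) \<in> L O J \<longleftrightarrow> (\<lambda>x. v (x + T), \<lambda>x. w (x + T)) \<in> L O J)"

text \<open>The graph of \<open>v \<mapsto> v\<^sub>x - A(\<cdot>, \<lambda>) v\<close> on \<open>L\<^sup>2\<close>, with \<open>v\<^sub>x = A v + g\<close> in integrated form;
  the first component is the (absolutely) continuous representative.\<close>

definition system_graph ::
    "(real \<Rightarrow> complex \<Rightarrow> complex^'k^'k) \<Rightarrow> complex \<Rightarrow> (real \<Rightarrow> complex^'k) rel" where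
  "system_graph A lam = {(v, g). v \<in> L2 \<and> g \<in> L2 \<and>
     (\<forall>a b. a \<le> b \<longrightarrow> ((\<lambda>x. A x lam *v v x + g x) has_integral (v b - v a)) {a..b})}"

definition L2_linear_on ::
    "(real \<Rightarrow> complex^'n) set \<Rightarrow> ((real \<Rightarrow> complex^'n) \<Rightarrow> (real \<Rightarrow> complex^'k)) \<Rightarrow> bool" where
  "L2_linear_on D F \<longleftrightarrow>
     (\<forall>u\<in>D. \<forall>v\<in>D. \<forall>c d. ae_eq (F (\<lambda>x. c *s u x + d *s v x)) (\<lambda>x. c *s F u x + d *s F v x)) \<and>
     (\<forall>u\<in>D. \<forall>v\<in>D. ae_eq u v \<longrightarrow> ae_eq (F u) (F v))"

text \<open>The problem \<open>(\<lambda> - P) v = g\<close> and the system \<open>y\<^sub>x = A(x, \<lambda>) y + b g\<close> are equivalent under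
  a linear change of unknown \<open>y = a v\<close> (typically \<open>v\<close> and its derivatives) and a linear map \<open>b\<close>
  on the inhomogeneities: solutions correspond to solutions, one to one for the homogeneous
  problems, and every inhomogeneity of the system can be brought to the form \<open>b g\<close> by subtracting
  a function \<open>u\<close> from the unknown. Example: for \<open>P = \<partial>\<^sub>x(q - \<partial>\<^sub>x\<^sub>x)\<close>, take
  \<open>a v = (v, v\<^sub>x, q v - v\<^sub>x\<^sub>x)\<close> and \<open>b g = (0, 0, -g)\<close>.\<close>

definition first_order_reformulation ::
    "(real \<Rightarrow> complex^'n) rel \<Rightarrow> (real \<Rightarrow> complex \<Rightarrow> complex^'k^'k) \<Rightarrow> bool" where
  "first_order_reformulation P A \<longleftrightarrow> (\<forall>lam. \<exists>a b.
     L2_linear_on (Domain P) a \<and> L2_linear_on L2 b \<and> b ` L2 \<subseteq> L2 \<and>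
     (\<forall>(v, g)\<in>shifted_graph P lam. (a v, b g) \<in> system_graph A lam) \<and>
     (\<forall>g\<in>L2. \<forall>u. (u, b g) \<in> system_graph A lam \<longrightarrow>
        (\<exists>v. (v, g) \<in> shifted_graph P lam \<and> ae_eq (a v) u)) \<and>
     (\<forall>(v, g)\<in>shifted_graph P lam.
        ae_eq g (\<lambda>_. 0) \<and> ae_eq (a v) (\<lambda>_. 0) \<longrightarrow> ae_eq v (\<lambda>_. 0)) \<and>
     (\<forall>h\<in>L2. \<exists>g\<in>L2. \<exists>u. (u, \<lambda>x. h x - b g x) \<in> system_graph A lam))"

text \<open>Here \<open>M\<close> is the monodromy matrix at \<open>lam\<close>.\<close>

definition essential_spectrum_with_mult ::
    "(real \<Rightarrow> complex^'n) rel \<Rightarrow> complex^'k^'k \<Rightarrow> complex \<Rightarrow> nat \<Rightarrow> bool" where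
  "essential_spectrum_with_mult P M lam m \<longleftrightarrow>
     lam \<in> essential_spectrum P \<and>
     card (circle_eigenvalues M) = m \<and> (\<forall>\<mu>\<in>circle_eigenvalues M. alg_mult M \<mu> = 1)"


section \<open>The discriminant and the deltoid\<close>

definition Delta3 :: "complex \<Rightarrow> real" where
  "Delta3 f = ((Re f)\<^sup>2 + (Im f)\<^sup>2)\<^sup>2 - 8 * ((Re f) ^ 3 - 3 * Re f * (Im f)\<^sup>2)
     + 18 * ((Re f)\<^sup>2 + (Im f)\<^sup>2) - 27"

definition deltoid :: "complex set" where
  "deltoid = (\<lambda>\<theta>. 2 * cis \<theta> + cis (- 2 * \<theta>)) ` {- pi..pi}"

end

theory Submission
  imports Defs "HOL-Computational_Algebra.Fundamental_Theorem_Algebra"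
    "HOL-Complex_Analysis.Conformal_Mappings"
begin

text \<open>
  Let \<open>M\<close> be the monodromy matrix at a point \<open>\<lambda>\<close> of the imaginary axis and \<open>f = tr M\<close>.
  The trace condition gives \<open>det M = 1\<close> by Liouville's formula. The symmetry (A2) makes
  \<open>V\<^sup>T(x,\<lambda>) B(\<lambda>) V(x,-\<lambda>)\<close> independent of \<open>x\<close>, so that \<open>M(-\<lambda>)\<close> is similar to the inverse
  transpose of \<open>M(\<lambda>)\<close> wherever \<open>B(\<lambda>)\<close> is invertible, and Schwarz reflection together with (A1)
  gives \<open>M(-\<lambda>) = cnj M(\<lambda>)\<close>. Hence the second elementary symmetric function of the eigenvalues,
  which is \<open>tr (M\<inverse>)\<close>, equals \<open>cnj f\<close>. The finitely many exceptional \<open>\<lambda>\<close> are covered because \<open>M\<close>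
  depends continuously on \<open>\<lambda>\<close> (\<open>trace_adjugate_V\<close>). So the characteristic polynomial is
  \<open>X\<^sup>3 - f X\<^sup>2 + cnj f X - 1\<close>.

  The roots of this cubic are invariant under the reflection \<open>z \<mapsto> 1 / cnj z\<close>. Either all three lie
  on the unit circle, or one lies on it and the others are a pair \<open>a\<close>, \<open>1 / cnj a\<close> of equal
  argument (\<open>reciprocal_cubic_root_cases\<close>). The discriminant of the cubic is \<open>\<Delta>\<^sub>3(f)\<close>. In terms of the roots it is
  \<open>-|(a - b) (b - c) (c - a)|\<^sup>2\<close> in the first case and plus the same square in the second
  (\<open>Delta3_circle\<close>, \<open>Delta3_off_circle\<close>), so its sign separates the cases. It vanishes exactly
  when \<open>f = 2a + 1 / a\<^sup>2\<close> with \<open>|a| = 1\<close>, which is the deltoid. On the components of the complement of the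
  deltoid the sign is therefore constant; it is negative at \<open>0\<close> and positive for \<open>|f| > 3\<close>.

  For the essential spectrum, let \<open>M\<close> have an eigenvalue on the unit circle. The adjoint
  system then has a solution \<open>w\<close> whose modulus is bounded and bounded away from zero. For an \<open>L\<^sup>2\<close>
  solution of \<open>u\<^sub>x = A u + h\<close> the scalar \<open>w \<cdot> u\<close> has the derivative \<open>w \<cdot> h\<close>. Inhomogeneities \<open>h\<close> are
  chosen in \<open>L\<^sup>2\<close> such that \<open>w \<cdot> h\<close> is the derivative of \<open>(1 + x)\<^sup>t\<close> on \<open>x \<ge> 0\<close>, for infinitely many
  exponents \<open>0 < t \<le> 1/3\<close>. If the range of the operator had finite codimension, a nontrivial
  combination of these \<open>h\<close> would lie in it, and then \<open>w \<cdot> u\<close> would be a constant plus a nontrivial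
  combination of distinct positive powers, hence bounded away from zero at infinity
  (\<open>infinite_codimension\<close>). Finite codimension for \<open>\<lambda> - J L\<close> carries over to the first-order system
  by linear algebra (\<open>system_range_finite_codimension\<close>).
\<close>

section \<open>Adjugate and characteristic polynomial of a three by three matrix\<close>

text \<open>For \<open>det M = 1\<close> this polynomial expression is the inverse of \<open>M\<close>. Working with it instead of an
  abstract inverse makes differentiability and continuity in the entries immediate.\<close>

definition adjugate3 :: "complex^3^3 \<Rightarrow> complex^3^3" where
  "adjugate3 M = vector
     [vector [M$2$2 * M$3$3 - M$2$3 * M$3$2, M$1$3 * M$3$2 - M$1$2 * M$3$3, M$1$2 * M$2$3 - M$1$3 * M$2$2],
      vector [M$2$3 * M$3$1 - M$2$1 * M$3$3, M$1$1 * M$3$3 - M$1$3 * M$3$1, M$1$3 * M$2$1 - M$1$1 * M$2$3],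
      vector [M$2$1 * M$3$2 - M$2$2 * M$3$1, M$1$2 * M$3$1 - M$1$1 * M$3$2, M$1$1 * M$2$2 - M$1$2 * M$2$1]]"

lemma adjugate3_right: "M ** adjugate3 M = (\<chi> i j. if i = j then det M else 0)"
  by (simp add: vec_eq_iff forall_3 matrix_matrix_mult_def sum_3 adjugate3_def det_3 algebra_simps)

lemma adjugate3_left: "adjugate3 M ** M = (\<chi> i j. if i = j then det M else 0)"
  by (simp add: vec_eq_iff forall_3 matrix_matrix_mult_def sum_3 adjugate3_def det_3 algebra_simps)

lemma adjugate3_inverse:
  assumes "det M = 1"
  shows "M ** adjugate3 M = mat 1" "adjugate3 M ** M = mat 1"
  using assms by (auto simp: adjugate3_right adjugate3_left mat_def vec_eq_iff)

lemma trace_3: "trace (M :: complex^3^3) = M$1$1 + M$2$2 + M$3$3"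
  by (simp add: trace_def sum_3)

text \<open>The middle coefficient is the sum of the principal minors, which is the trace of the adjugate.\<close>

lemma char_polynomial_3:
  fixes M :: "complex^3^3"
  shows "char_polynomial M = [: - det M, trace (adjugate3 M), - trace M, 1 :]"
  by (simp add: char_polynomial_def det_3 trace_3 adjugate3_def algebra_simps)

lemma poly_char_polynomial_3:
  fixes M :: "complex^3^3"
  shows "poly (char_polynomial M) \<mu> = det (mat \<mu> - M)"
  by (simp add: char_polynomial_def det_3 mat_def algebra_simps)

lemma eigenvalues_eq_roots:
  fixes M :: "complex^3^3"
  shows "eigenvalues M = {\<mu>. poly (char_polynomial M) \<mu> = 0}"
proof -
  have "(\<exists>v. v \<noteq> 0 \<and> M *v v = \<mu> *s v) \<longleftrightarrow> det (mat \<mu> - M) = 0" for \<mu>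
  proof -
    have "(mat \<mu> - M) *v v = \<mu> *s v - M *v v" for v
      by (simp add: vec_eq_iff forall_3 matrix_vector_mult_def mat_def sum_3 algebra_simps)
    then have "(mat \<mu> - M) *v v = 0 \<longleftrightarrow> M *v v = \<mu> *s v" for v
      by (metis right_minus_eq)
    then have "(\<exists>v. v \<noteq> 0 \<and> M *v v = \<mu> *s v) \<longleftrightarrow> \<not> (\<forall>v. (mat \<mu> - M) *v v = 0 \<longrightarrow> v = 0)"
      by blast
    also have "\<dots> \<longleftrightarrow> det (mat \<mu> - M) = 0"
      unfolding matrix_left_invertible_ker[symmetric] invertible_left_inverse[symmetric]
      by (simp add: invertible_det_nz)
    finally show ?thesis .
  qed
  then show ?thesis
    by (simp add: eigenvalues_def poly_char_polynomial_3)
qed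


section \<open>Cubics whose roots are symmetric in the unit circle\<close>

text \<open>The characteristic polynomial of a matrix with determinant \<open>1\<close> and trace \<open>f\<close> whose inverse has trace \<open>cnj f\<close>.\<close>

definition reciprocal_cubic :: "complex \<Rightarrow> complex poly" where
  "reciprocal_cubic f = [: - 1, cnj f, - f, 1 :]"

abbreviation monic_roots :: "complex \<Rightarrow> complex \<Rightarrow> complex \<Rightarrow> complex poly" where
  "monic_roots a b c \<equiv> [: - a, 1 :] * [: - b, 1 :] * [: - c, 1 :]"

lemma poly_monic_roots: "poly (monic_roots a b c) x = (x - a) * (x - b) * (x - c)"
  unfolding poly_mult by simp

lemma vieta:
  "reciprocal_cubic f = monic_roots a b c \<longleftrightarrow>
     f = a + b + c \<and> cnj f = a * b + b * c + c * a \<and> a * b * c = 1"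
proof -
  have exp: "monic_roots a b c = [: - (a * b * c), a * b + b * c + c * a, - (a + b + c), 1 :]"
    by (simp add: algebra_simps)
  show ?thesis
    unfolding reciprocal_cubic_def exp pCons_eq_iff neg_equal_iff_equal eq_commute[of 1 "a * b * c"]
    by blast
qed

text \<open>The complex numbers are algebraically closed.\<close>

lemma reciprocal_cubic_splits: "\<exists>a b c. reciprocal_cubic f = monic_roots a b c"
proof -
  have ne: "reciprocal_cubic f \<noteq> 0" and deg: "degree (reciprocal_cubic f) = 3"
    and lead: "lead_coeff (reciprocal_cubic f) = 1"
    by (simp_all add: reciprocal_cubic_def)
  obtain R where R: "size R = degree (reciprocal_cubic f)"
    "reciprocal_cubic f = smult (lead_coeff (reciprocal_cubic f)) (\<Prod>x\<in>#R. [: - x, 1 :])"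
    using alg_closed_imp_factorization[OF ne] by blast
  from R(1) deg have "size R = Suc (Suc (Suc 0))" by simp
  then obtain a R1 where "R = add_mset a R1" "size R1 = Suc (Suc 0)"
    by (metis size_eq_Suc_imp_eq_union size_add_mset nat.inject)
  moreover from this obtain b R2 where "R1 = add_mset b R2" "size R2 = Suc 0"
    by (metis size_eq_Suc_imp_eq_union size_add_mset nat.inject)
  moreover from this obtain c where "R2 = {#c#}"
    by (metis size_eq_Suc_imp_eq_union size_add_mset nat.inject size_eq_0_iff_empty)
  ultimately have "R = {#a, b, c#}" by simp
  with R(2) lead show ?thesis
    by (intro exI[of _ a] exI[of _ b] exI[of _ c]) (simp add: mult.assoc)
qed

lemma order_monic_roots:
  "order \<mu> (monic_roots a b c) = of_bool (\<mu> = a) + of_bool (\<mu> = b) + of_bool (\<mu> = c)"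
proof -
  have lin: "order \<mu> [: - a, 1 :] = of_bool (\<mu> = a)" for a :: complex
    using order_power_n_n[of a 1] by (auto simp: order_0I)
  have "order \<mu> (p * q * r) = order \<mu> p + order \<mu> q + order \<mu> r"
    if "p \<noteq> 0" "q \<noteq> 0" "r \<noteq> 0" for p q r :: "complex poly"
    using that by (simp add: order_mult)
  from this[of "[: - a, 1 :]" "[: - b, 1 :]" "[: - c, 1 :]"]
  have "order \<mu> (monic_roots a b c) = order \<mu> [: - a, 1 :] + order \<mu> [: - b, 1 :] + order \<mu> [: - c, 1 :]"
    by (simp only: pCons_eq_0_iff one_neq_zero) simp
  then show ?thesis
    by (simp add: lin)
qed

text \<open>Conjugating the equation for \<open>a\<close> and dividing by \<open>- (cnj a)\<^sup>3\<close> reproduces the cubic at \<open>1 / cnj a\<close>.\<close>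

lemma poly_reciprocal_cubic_reflect:
  assumes "poly (reciprocal_cubic f) a = 0"
  shows "poly (reciprocal_cubic f) (inverse (cnj a)) = 0"
proof -
  have a0: "a \<noteq> 0"
    using assms by (auto simp: reciprocal_cubic_def)
  have "cnj (poly (reciprocal_cubic f) a) = 0"
    using assms by simp
  then have "cnj a ^ 3 - cnj f * cnj a ^ 2 + f * cnj a - 1 = 0"
    by (simp add: reciprocal_cubic_def algebra_simps power3_eq_cube power2_eq_square)
  moreover have "poly (reciprocal_cubic f) (inverse (cnj a)) =
      - (cnj a ^ 3 - cnj f * cnj a ^ 2 + f * cnj a - 1) / cnj a ^ 3"
    using a0 by (simp add: reciprocal_cubic_def field_simps power3_eq_cube power2_eq_square)
  ultimately show ?thesis by simp
qed

text \<open>The reflection permutes the roots, fixes precisely those on the unit circle, and there are three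
  roots with product \<open>1\<close>.\<close>

lemma reciprocal_cubic_root_cases:
  obtains (circle) a b c where "reciprocal_cubic f = monic_roots a b c"
      "cmod a = 1" "cmod b = 1" "cmod c = 1"
  | (off_circle) a c where "reciprocal_cubic f = monic_roots a (inverse (cnj a)) c"
      "a \<noteq> 0" "cmod a < 1" "cmod c = 1"
proof -
  \<comment> \<open>If a root \<open>p\<close> is off the circle, its mirror image is the second root and the third is \<open>cnj p / p\<close>.\<close>
  have off: thesis if fac: "reciprocal_cubic f = monic_roots p q r" and p: "cmod p \<noteq> 1" for p q r
  proof -
    have pqr: "p * q * r = 1" using fac vieta by blast
    then have p0: "p \<noteq> 0" by auto
    have "poly (reciprocal_cubic f) p = 0" by (simp only: fac poly_monic_roots) simp
    from poly_reciprocal_cubic_reflect[OF this]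
    have "(inverse (cnj p) - p) * (inverse (cnj p) - q) * (inverse (cnj p) - r) = 0"
      by (simp only: fac poly_monic_roots)
    moreover have "inverse (cnj p) \<noteq> p"
    proof
      assume "inverse (cnj p) = p"
      then have "p * cnj p = inverse (cnj p) * cnj p" by simp
      also have "\<dots> = 1" using p0 by simp
      finally have "complex_of_real ((cmod p)\<^sup>2) = 1" by (simp only: complex_norm_square)
      then have "(cmod p)\<^sup>2 = 1" by (simp only: of_real_eq_1_iff)
      then show False using p norm_ge_zero[of p] by (auto simp: power2_eq_1_iff simp del: norm_ge_zero)
    qed
    ultimately have "inverse (cnj p) = q \<or> inverse (cnj p) = r" by simp
    then obtain s where s: "reciprocal_cubic f = monic_roots p (inverse (cnj p)) s"
    proof
      assume "inverse (cnj p) = q"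
      then show ?thesis using fac that by simp
    next
      assume "inverse (cnj p) = r"
      moreover have "monic_roots p q r = monic_roots p r q" by (simp only: mult_ac)
      ultimately show ?thesis using fac that by simp
    qed
    then have "p * inverse (cnj p) * s = 1" using vieta by blast
    then have "cmod p * inverse (cmod p) * cmod s = 1"
      by (metis norm_mult norm_inverse complex_mod_cnj norm_one)
    then have cs: "cmod s = 1" using p0 by simp
    show thesis
    proof (cases "cmod p < 1")
      case True
      then show ?thesis using off_circle s p0 cs by blast
    next
      case False
      with p have small: "cmod (inverse (cnj p)) < 1"
        by (simp add: norm_inverse inverse_less_1_iff)
      have nz: "inverse (cnj p) \<noteq> 0" using p0 by simp
      have "reciprocal_cubic f = monic_roots (inverse (cnj p)) (inverse (cnj (inverse (cnj p)))) s"
        unfolding s by (simp only: mult_ac complex_cnj_inverse inverse_inverse_eq complex_cnj_cnj)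
      from off_circle[OF this nz small cs] show ?thesis .
    qed
  qed
  obtain a b c where fac: "reciprocal_cubic f = monic_roots a b c"
    using reciprocal_cubic_splits by blast
  then have "reciprocal_cubic f = monic_roots b a c" "reciprocal_cubic f = monic_roots c a b"
    by (simp_all only: mult_ac)
  with fac show thesis
    using circle off by blast
qed


section \<open>The discriminant and the deltoid\<close>

lemma Delta3_complex:
  "complex_of_real (Delta3 f) =
     of_real (cmod f ^ 4) - 4 * f ^ 3 - 4 * cnj f ^ 3 + 18 * of_real ((cmod f)\<^sup>2) - 27"
proof -
  have "cmod f ^ 4 = ((Re f)\<^sup>2 + (Im f)\<^sup>2)\<^sup>2"
    by (simp flip: cmod_power2)
  then show ?thesis
    unfolding cmod_power2
    by (simp add: complex_eq_iff Delta3_def power3_eq_cube power2_eq_square algebra_simps)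
qed

text \<open>Inserting \<open>abc = 1\<close> homogenizes \<open>\<Delta>\<^sub>3\<close> to the classical formula
  \<open>e\<^sub>1\<^sup>2 e\<^sub>2\<^sup>2 - 4 e\<^sub>2\<^sup>3 - 4 e\<^sub>1\<^sup>3 e\<^sub>3 + 18 e\<^sub>1 e\<^sub>2 e\<^sub>3 - 27 e\<^sub>3\<^sup>2\<close> for the discriminant.\<close>

lemma Delta3_discriminant:
  assumes "reciprocal_cubic f = monic_roots a b c"
  shows "complex_of_real (Delta3 f) = ((a - b) * (b - c) * (c - a))\<^sup>2"
proof -
  have f: "f = a + b + c" "cnj f = a * b + b * c + c * a" and abc: "a * b * c = 1"
    using assms vieta by blast+
  have "complex_of_real ((cmod f)\<^sup>2) = f * cnj f"
    by (rule complex_norm_square)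
  moreover have "cmod f ^ 4 = ((cmod f)\<^sup>2)\<^sup>2"
    by (simp flip: power_mult)
  ultimately have n: "complex_of_real ((cmod f)\<^sup>2) = f * cnj f"
      "complex_of_real (cmod f ^ 4) = (f * cnj f)\<^sup>2"
    by (simp_all only: of_real_power)
  have "complex_of_real (Delta3 f) =
      (f * cnj f)\<^sup>2 - 4 * f ^ 3 * (a * b * c) - 4 * cnj f ^ 3 + 18 * (f * cnj f) * (a * b * c) - 27 * (a * b * c)\<^sup>2"
    unfolding Delta3_complex abc n by simp
  also have "\<dots> = ((a - b) * (b - c) * (c - a))\<^sup>2"
    unfolding f(2) unfolding f(1) by algebra
  finally show ?thesis .
qed

lemma cnj_unit: "cmod z = 1 \<Longrightarrow> cnj z = inverse z"
  by (rule inverse_unique[symmetric]) (simp flip: complex_norm_square)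

text \<open>On the circle \<open>cnj (a - b) = 1/a - 1/b = - (a - b) / (ab)\<close>. Multiplying the three such identities
  shows that the product \<open>D\<close> of the differences satisfies \<open>cnj D = - D\<close>, so \<open>D\<^sup>2 = - |D|\<^sup>2\<close>.\<close>

lemma Delta3_circle:
  assumes fac: "reciprocal_cubic f = monic_roots a b c"
    and unit: "cmod a = 1" "cmod b = 1" "cmod c = 1"
  shows "Delta3 f = - (cmod ((a - b) * (b - c) * (c - a)))\<^sup>2"
proof -
  have nz: "a \<noteq> 0" "b \<noteq> 0" "c \<noteq> 0" using unit by auto
  have abc: "a * b * c = 1" using fac vieta by blast
  let ?D = "(a - b) * (b - c) * (c - a)"
  have "cnj (a - b) = - (a - b) / (a * b)" "cnj (b - c) = - (b - c) / (b * c)" "cnj (c - a) = - (c - a) / (c * a)"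
    using nz by (simp_all add: cnj_unit unit divide_simps)
  note conjugates = this
  have "- x / (a * b) * (- y / (b * c)) * (- z / (c * a)) = - (x * y * z) / (a * b * c)\<^sup>2" for x y z
    by (simp add: power2_eq_square mult_ac)
  then have "cnj ?D = - ?D / (a * b * c)\<^sup>2"
    unfolding complex_cnj_mult conjugates .
  then have "complex_of_real ((cmod ?D)\<^sup>2) = - ?D\<^sup>2"
    unfolding complex_norm_square abc by (simp add: power2_eq_square)
  then have "complex_of_real (Delta3 f) = complex_of_real (- (cmod ?D)\<^sup>2)"
    using Delta3_discriminant[OF fac] by (metis minus_minus of_real_minus)
  then show ?thesis by (simp only: of_real_eq_iff)
qed

text \<open>Conjugation now exchanges \<open>a\<close> with \<open>1/b\<close> and \<open>b\<close> with \<open>1/a\<close>. This flips one more sign than on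
  the circle, so the product \<open>D\<close> of the differences is real. It is nonzero since the three moduli differ.\<close>

lemma Delta3_off_circle:
  assumes fac: "reciprocal_cubic f = monic_roots a (inverse (cnj a)) c"
    and "a \<noteq> 0" "cmod a < 1" and unit: "cmod c = 1"
  shows "Delta3 f > 0"
proof -
  define b where "b = inverse (cnj a)"
  have b: "cmod b > 1" using assms by (simp add: b_def norm_inverse one_less_inverse_iff)
  have nz: "a \<noteq> 0" "b \<noteq> 0" "c \<noteq> 0" using assms b by auto
  have cn: "cnj a = inverse b" "cnj b = inverse a" "cnj c = inverse c"
    by (auto simp: b_def unit cnj_unit)
  have abc: "a * b * c = 1" using fac vieta unfolding b_def by blast
  let ?D = "(a - b) * (b - c) * (c - a)"
  have "cnj (a - b) = (a - b) / (a * b)" "cnj (b - c) = (c - a) / (c * a)" "cnj (c - a) = (b - c) / (b * c)"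
    using nz by (simp_all add: cn divide_simps)
  note conjugates = this
  have "cnj ?D = ?D / (a * b * c)\<^sup>2"
    unfolding complex_cnj_mult conjugates by (simp add: power2_eq_square mult_ac)
  then have "complex_of_real ((cmod ?D)\<^sup>2) = ?D\<^sup>2"
    unfolding complex_norm_square abc by (simp add: power2_eq_square)
  then have "Delta3 f = (cmod ?D)\<^sup>2"
    using Delta3_discriminant fac unfolding b_def by (metis of_real_eq_iff)
  moreover have "a \<noteq> b" "b \<noteq> c" "c \<noteq> a" using assms b by auto
  ultimately show ?thesis by simp
qed

lemma Delta3_pos_imp_off_circle:
  assumes "Delta3 f > 0"
  obtains a c where "reciprocal_cubic f = monic_roots a (inverse (cnj a)) c"
    "a \<noteq> 0" "cmod a < 1" "cmod c = 1"
proof (cases rule: reciprocal_cubic_root_cases[of f])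
  case (circle a b c)
  have "Delta3 f \<le> 0"
    unfolding Delta3_circle[OF circle] by simp
  with assms show thesis by simp
next
  case (off_circle a c)
  then show thesis using that by blast
qed

lemma Delta3_nonpos_imp_circle:
  assumes "Delta3 f \<le> 0"
  obtains a b c where "reciprocal_cubic f = monic_roots a b c"
    "cmod a = 1" "cmod b = 1" "cmod c = 1" "Delta3 f < 0 \<longleftrightarrow> a \<noteq> b \<and> b \<noteq> c \<and> c \<noteq> a"
proof (cases rule: reciprocal_cubic_root_cases[of f])
  case (circle a b c)
  show thesis
    using that[OF circle] unfolding Delta3_circle[OF circle] by (auto simp: zero_less_power2)
next
  case (off_circle a c)
  from Delta3_off_circle[OF this] assms show thesis by simp
qed

lemma Delta3_zero_imp_double_root:
  assumes "Delta3 f = 0"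
  obtains a c where "reciprocal_cubic f = monic_roots a a c" "cmod a = 1" "cmod c = 1"
proof -
  obtain a b c where fac: "reciprocal_cubic f = monic_roots a b c"
    and unit: "cmod a = 1" "cmod b = 1" "cmod c = 1"
    and "Delta3 f < 0 \<longleftrightarrow> a \<noteq> b \<and> b \<noteq> c \<and> c \<noteq> a"
    using Delta3_nonpos_imp_circle[of f] assms by auto
  with assms consider "a = b" | "b = c" | "c = a" by auto
  then show thesis
  proof cases
    case 1
    then show ?thesis using that fac unit by simp
  next
    case 2
    have "monic_roots a b b = monic_roots b b a" by (simp only: mult_ac)
    then show ?thesis using that[of b a] fac unit 2 by simp
  next
    case 3
    have "monic_roots a b a = monic_roots a a b" by (simp only: mult_ac)
    then show ?thesis using that[of a b] fac unit 3 by simp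
  qed
qed

text \<open>A double root \<open>a = e\<^sup>i\<^sup>\<theta>\<close> forces the third root to be \<open>e\<^sup>-\<^sup>2\<^sup>i\<^sup>\<theta>\<close>, and the sum of the
  roots is then the point of the deltoid with parameter \<open>\<theta>\<close>.\<close>

lemma deltoid_iff_Delta3: "f \<in> deltoid \<longleftrightarrow> Delta3 f = 0"
proof
  assume "f \<in> deltoid"
  then obtain \<theta> where "f = 2 * cis \<theta> + cis (- 2 * \<theta>)"
    by (auto simp: deltoid_def)
  then have "reciprocal_cubic f = monic_roots (cis \<theta>) (cis \<theta>) (cis (- 2 * \<theta>))"
    unfolding vieta by (simp add: cis_mult cis_cnj)
  from Delta3_discriminant[OF this] show "Delta3 f = 0" by simp
next
  assume "Delta3 f = 0"
  then obtain a c where fac: "reciprocal_cubic f = monic_roots a a c"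
    and a: "cmod a = 1" and c: "cmod c = 1"
    by (rule Delta3_zero_imp_double_root)
  have "a * a * c = 1" and f: "f = a + a + c" using fac vieta by blast+
  then have "c = inverse (a * a)" by (metis inverse_unique)
  moreover have cis: "a = cis (Arg a)" using a cis_Arg[of a] by (force simp: sgn_eq)
  ultimately have "c = inverse (cis (Arg a) * cis (Arg a))" by simp
  then have "c = cis (- 2 * Arg a)" by (simp add: cis_mult cis_inverse)
  with f cis have "f = 2 * cis (Arg a) + cis (- 2 * Arg a)" by (metis mult_2)
  moreover have "Arg a \<in> {- pi..pi}" using Arg_bounded[of a] by auto
  ultimately show "f \<in> deltoid" unfolding deltoid_def by blast
qed

text \<open>Intermediate value theorem: \<open>\<Delta>\<^sub>3\<close> is continuous and vanishes only on the deltoid.\<close>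

lemma Delta3_sign_constant:
  assumes "connected C" "C \<inter> deltoid = {}" "x \<in> C" "y \<in> C"
  shows "Delta3 x < 0 \<longleftrightarrow> Delta3 y < 0"
proof -
  have "continuous_on C Delta3"
    unfolding Delta3_def by (intro continuous_intros)
  then have conn: "connected (Delta3 ` C)"
    using assms(1) by (rule connected_continuous_image)
  have nz: "0 \<notin> Delta3 ` C"
    using assms(2) deltoid_iff_Delta3 by (metis disjoint_iff imageE)
  have "\<not> (Delta3 u \<le> 0 \<and> 0 \<le> Delta3 v)" if "u \<in> C" "v \<in> C" for u v
    using connectedD_interval[OF conn, of "Delta3 u" "Delta3 v" 0] nz that by blast
  with assms(3,4) show ?thesis by (metis less_eq_real_def not_less)
qed

lemma Delta3_inside_deltoid:
  assumes "f \<in> connected_component_set (- deltoid) 0"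
  shows "Delta3 f < 0"
proof -
  let ?C = "connected_component_set (- deltoid) 0"
  have "0 \<in> ?C" using assms
    by (metis connected_component_in connected_component_refl mem_Collect_eq)
  moreover have "?C \<inter> deltoid = {}"
    using connected_component_subset[of "- deltoid" 0] by blast
  moreover have "Delta3 0 < 0" by (simp add: Delta3_def)
  ultimately show ?thesis
    using Delta3_sign_constant[OF connected_connected_component, of "- deltoid" 0 0 f] assms by blast
qed

text \<open>An unbounded component contains points of modulus greater than \<open>3\<close>, which are not sums of
  three numbers on the unit circle.\<close>

lemma Delta3_outside_deltoid:
  assumes "f \<in> outside deltoid"
  shows "Delta3 f > 0"
proof -
  let ?C = "connected_component_set (- deltoid) f"
  have f: "f \<notin> deltoid" and unbounded: "\<not> bounded ?C"
    using assms by (auto simp: outside_def)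
  from unbounded obtain y where y: "y \<in> ?C" "cmod y > 3"
    unfolding bounded_iff by (meson not_le)
  have C: "?C \<inter> deltoid = {}"
    using connected_component_subset[of "- deltoid" f] by blast
  have fC: "f \<in> ?C" using f by simp
  have "\<not> Delta3 y \<le> 0"
  proof
    assume "Delta3 y \<le> 0"
    then obtain a b c where fac: "reciprocal_cubic y = monic_roots a b c"
      and "cmod a = 1" "cmod b = 1" "cmod c = 1"
      by (rule Delta3_nonpos_imp_circle)
    moreover have "y = a + b + c" using fac vieta by blast
    ultimately have "cmod y \<le> 3"
      using norm_triangle_ineq[of "a + b" c] norm_triangle_ineq[of a b] by simp
    with y show False by simp
  qed
  then have "\<not> Delta3 f < 0"
    using Delta3_sign_constant[OF connected_connected_component C fC y(1)] by simp
  moreover have "Delta3 f \<noteq> 0" using f deltoid_iff_Delta3 by blast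
  ultimately show ?thesis by simp
qed


section \<open>Eigenvalues read off from a factorization\<close>

lemma spectrum_from_factorization:
  fixes M :: "complex^3^3"
  assumes "char_polynomial M = monic_roots a b c"
  shows "eigenvalues M = {a, b, c}"
    and "alg_mult M \<mu> = of_bool (\<mu> = a) + of_bool (\<mu> = b) + of_bool (\<mu> = c)"
proof -
  show "eigenvalues M = {a, b, c}"
    unfolding eigenvalues_eq_roots assms poly_monic_roots by auto
  show "alg_mult M \<mu> = of_bool (\<mu> = a) + of_bool (\<mu> = b) + of_bool (\<mu> = c)"
    unfolding alg_mult_def assms by (rule order_monic_roots)
qed

text \<open>The multiplicities of the roots \<open>a\<close>, \<open>b\<close>, \<open>c\<close>, which may coincide, add up to three.\<close>

lemma circle_spectrum:
  fixes M :: "complex^3^3"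
  assumes fac: "char_polynomial M = monic_roots a b c"
    and unit: "cmod a = 1" "cmod b = 1" "cmod c = 1"
  shows "circle_eigenvalues M = {a, b, c}" and "circle_count M = 3"
proof -
  show eig: "circle_eigenvalues M = {a, b, c}"
    using unit by (auto simp: circle_eigenvalues_def spectrum_from_factorization[OF fac])
  have "(\<Sum>\<mu>\<in>{a, b, c}. of_bool (\<mu> = z)) = (1::nat)" if "z \<in> {a, b, c}" for z
    using that sum.delta[of "{a, b, c}" z "\<lambda>_. 1::nat"] by (simp only: of_bool_def) auto
  from this[of a] this[of b] this[of c] show "circle_count M = 3"
    unfolding circle_count_def eig spectrum_from_factorization[OF fac] sum.distrib
    by (simp only: insert_iff simp_thms)
qed

text \<open>The arguments agree since \<open>1 / cnj a\<close> is the positive multiple \<open>a / |a|\<^sup>2\<close> of \<open>a\<close>.\<close>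

lemma off_circle_spectrum:
  fixes M :: "complex^3^3"
  assumes fac: "char_polynomial M = monic_roots a (inverse (cnj a)) c"
    and a: "a \<noteq> 0" "cmod a < 1" and c: "cmod c = 1"
  shows "eigenvalues M = {c, a, inverse (cnj a)}" and "circle_count M = 1"
    and "cmod (inverse (cnj a)) > 1" and "Arg a = Arg (inverse (cnj a))"
proof -
  show eig: "eigenvalues M = {c, a, inverse (cnj a)}"
    unfolding spectrum_from_factorization[OF fac] by auto
  show big: "cmod (inverse (cnj a)) > 1"
    using a by (simp add: norm_inverse one_less_inverse_iff)
  have "circle_eigenvalues M = {c}"
    using a c big by (auto simp: circle_eigenvalues_def eig)
  moreover have "c \<noteq> a" "c \<noteq> inverse (cnj a)" using a c big by auto
  ultimately show "circle_count M = 1"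
    unfolding circle_count_def spectrum_from_factorization[OF fac] by simp
  have "inverse (cnj a) = a * complex_of_real (inverse ((cmod a)\<^sup>2))"
    using a complex_norm_square[of a] by (simp add: field_simps)
  moreover have "Arg (a * complex_of_real (inverse ((cmod a)\<^sup>2))) = Arg a"
    using a by (simp only: Arg_times_of_real2 zero_less_power positive_imp_inverse_positive zero_less_norm_iff simp_thms)
  ultimately show "Arg a = Arg (inverse (cnj a))" by simp
qed

lemma cube_root_of_unity:
  "\<omega> ^ 3 = 1 \<longleftrightarrow> \<omega> \<in> {1, cis (2 * pi / 3), cis (4 * pi / 3)}"
proof -
  have roots: "{z :: complex. z ^ 3 = 1} = (\<lambda>k. cis (2 * pi * real k / real 3)) ` {..<3}"
    using Complex.bij_betw_roots_unity[of 3] by (simp add: bij_betw_def)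
  have "{..<3 :: nat} = {0, 1, 2}" by auto
  with roots have "{z :: complex. z ^ 3 = 1} = {1, cis (2 * pi / 3), cis (4 * pi / 3)}"
    by (simp add: mult.commute)
  then show ?thesis by blast
qed


section \<open>Traceless linear systems\<close>

lemma bilinear_matrix_mult: "bilinear ((**) :: complex^3^3 \<Rightarrow> complex^3^3 \<Rightarrow> complex^3^3)"
  unfolding bilinear_def linear_iff
  by (simp add: vec_eq_iff matrix_matrix_mult_def sum.distrib scaleR_sum_right algebra_simps)

interpretation mult3: bounded_bilinear "(**) :: complex^3^3 \<Rightarrow> complex^3^3 \<Rightarrow> complex^3^3"
  using bilinear_matrix_mult by (simp only: bilinear_conv_bounded_bilinear)

lemma has_vector_derivative_entry:
  assumes "(f has_vector_derivative f') F"
  shows "((\<lambda>x. f x $ i) has_vector_derivative f' $ i) F"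
  using bounded_linear.has_vector_derivative[OF bounded_linear_vec_nth assms] .

lemma differentiable_entrywise:
  fixes f :: "real \<Rightarrow> 'a::euclidean_space^'n"
  assumes "\<And>i. (\<lambda>x. f x $ i) differentiable (at x)"
  shows "f differentiable (at x)"
proof (rule iffD2[OF differentiable_componentwise_within], rule ballI)
  fix b :: "'a^'n" assume "b \<in> Basis"
  then obtain i u where b: "b = axis i u" "u \<in> Basis"
    by (auto simp: Basis_vec_def)
  have "(\<lambda>x. f x $ i) differentiable (at x)" by (rule assms)
  then have "(\<lambda>x. f x $ i \<bullet> u) differentiable (at x)"
    by (rule iffD1[OF differentiable_componentwise_within, rule_format]) (rule b(2))
  then show "(\<lambda>x. f x \<bullet> b) differentiable (at x)"
    by (simp add: b(1) inner_axis)
qed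

lemma constant_if_derivative_zero:
  fixes f :: "real \<Rightarrow> 'a::real_normed_vector"
  assumes "\<And>x. (f has_vector_derivative 0) (at x)"
  shows "f x = f y"
  using has_vector_derivative_zero_constant[of UNIV f] assms by (metis UNIV_I convex_UNIV)

lemma norm_increment_le:
  fixes f :: "real \<Rightarrow> 'a::real_normed_vector"
  assumes f: "\<And>x. x \<in> {a..b} \<Longrightarrow> (f has_vector_derivative f' x) (at x)"
    and B: "\<And>x. x \<in> {a..b} \<Longrightarrow> norm (f' x) \<le> B" and ab: "a \<le> b"
  shows "norm (f b - f a) \<le> B * (b - a)"
proof -
  have "0 \<le> B" using order_trans[OF norm_ge_zero B[of a]] ab by simp
  have "norm (f b - f a) \<le> B * norm (b - a)"
  proof (rule differentiable_bound[of "{a..b}" f "\<lambda>x h. h *\<^sub>R f' x"])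
    fix x assume x: "x \<in> {a..b}"
    show "(f has_derivative (\<lambda>h. h *\<^sub>R f' x)) (at x within {a..b})"
      using f[OF x] by (simp add: has_vector_derivative_def has_derivative_at_withinI)
    show "onorm (\<lambda>h. h *\<^sub>R f' x) \<le> B"
      using \<open>0 \<le> B\<close> B[OF x] by (intro onorm_bound) (simp_all add: mult.commute[of B] mult_left_mono)
  qed (use ab in auto)
  then show ?thesis using ab by simp
qed

locale traceless_system =
  fixes A V :: "real \<Rightarrow> complex^3^3"
  assumes ode: "\<And>x. (V has_vector_derivative A x ** V x) (at x)"
    and init: "V 0 = mat 1"
    and traceless: "\<And>x. trace (A x) = 0"
begin

text \<open>Liouville's formula \<open>(det V)\<^sub>x = tr A det V\<close>.\<close>

lemma det_V: "det (V x) = 1"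
proof -
  have entry: "((\<lambda>x. V x $ i $ j) has_vector_derivative (A x ** V x) $ i $ j) (at x)" for x i j
    by (rule has_vector_derivative_entry[OF has_vector_derivative_entry[OF ode]])
  have "((\<lambda>x. det (V x)) has_vector_derivative trace (A x) * det (V x)) (at x)" for x
    unfolding det_3
    by (rule has_vector_derivative_eq_rhs, (rule derivative_intros entry)+)
      (simp add: matrix_matrix_mult_def sum_3 trace_3 algebra_simps)
  then have "det (V x) = det (V 0)"
    by (intro constant_if_derivative_zero) (simp add: traceless)
  then show ?thesis by (simp add: init)
qed

definition V_inv :: "real \<Rightarrow> complex^3^3" where
  "V_inv x = adjugate3 (V x)"

lemma V_V_inv: "V x ** V_inv x = mat 1" and V_inv_V: "V_inv x ** V x = mat 1"
  by (simp_all add: V_inv_def adjugate3_inverse det_V)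

text \<open>The entries of \<open>V\<inverse>\<close> are polynomials in those of \<open>V\<close>, so \<open>V\<inverse>\<close> is differentiable. Its derivative
  is then determined by differentiating \<open>V\<inverse> V = 1\<close>.\<close>

lemma V_inv_ode: "(V_inv has_vector_derivative - (V_inv x ** A x)) (at x)"
proof -
  have entry: "(\<lambda>x. V x $ i $ j) differentiable (at x)" for i j
    by (rule differentiableI_vector[OF has_vector_derivative_entry[OF has_vector_derivative_entry[OF ode]]])
  have "V_inv differentiable (at x)"
  proof (intro differentiable_entrywise)
    fix i j :: 3
    show "(\<lambda>x. V_inv x $ i $ j) differentiable (at x)"
      using exhaust_3[of i] exhaust_3[of j]
      by (auto simp: V_inv_def adjugate3_def intro!: differentiable_diff differentiable_mult entry)
  qed
  then obtain D where D: "(V_inv has_vector_derivative D) (at x)"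
    by (auto simp: vector_derivative_works)
  have "((\<lambda>x. V_inv x ** V x) has_vector_derivative V_inv x ** (A x ** V x) + D ** V x) (at x)"
    by (rule mult3.has_vector_derivative[OF D ode])
  moreover have "((\<lambda>x. V_inv x ** V x) has_vector_derivative 0) (at x)"
    by (simp add: V_inv_V)
  ultimately have "V_inv x ** (A x ** V x) + D ** V x = 0"
    by (rule vector_derivative_unique_at)
  then have "D ** V x = - (V_inv x ** A x) ** V x"
    by (simp add: mult3.minus_left matrix_mul_assoc add_eq_0_iff)
  then have "D ** (V x ** V_inv x) = - (V_inv x ** A x) ** (V x ** V_inv x)"
    by (simp only: matrix_mul_assoc)
  with D show ?thesis by (simp add: V_V_inv)
qed

text \<open>Uniqueness of solutions by variation of constants: \<open>V\<inverse> Y\<close> has derivative zero.\<close>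

lemma solution_eq:
  fixes Y :: "real \<Rightarrow> complex^3^3"
  assumes "\<And>x. (Y has_vector_derivative A x ** Y x) (at x)"
  shows "Y x = V x ** Y 0"
proof -
  have "((\<lambda>x. V_inv x ** Y x) has_vector_derivative V_inv x ** (A x ** Y x) + - (V_inv x ** A x) ** Y x) (at x)" for x
    by (rule mult3.has_vector_derivative[OF V_inv_ode[of x] assms[of x]])
  then have "V_inv x ** Y x = V_inv 0 ** Y 0"
    by (intro constant_if_derivative_zero) (simp add: mult3.minus_left matrix_mul_assoc)
  moreover have "V_inv 0 = mat 1" using V_V_inv[of 0] by (simp add: init)
  ultimately have "V x ** (V_inv x ** Y x) = V x ** Y 0" by simp
  then show ?thesis by (simp add: matrix_mul_assoc V_V_inv)
qed

lemma floquet: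
  assumes "\<And>x. A (x + T) = A x"
  shows "V (x + T) = V x ** V T"
proof -
  have "((\<lambda>x. V (x + T)) has_vector_derivative A x ** V (x + T)) (at x)" for x
  proof -
    have "((\<lambda>x. x + T) has_vector_derivative 1) (at x)"
      by (auto intro!: derivative_eq_intros)
    from vector_diff_chain_at[OF this ode[of "x + T"]] show ?thesis
      by (simp add: o_def assms)
  qed
  from solution_eq[of "\<lambda>x. V (x + T)", OF this, of x] show ?thesis by simp
qed

text \<open>Continuous dependence on the coefficients. With \<open>Y = V Z\<close> the perturbed equation becomes
  \<open>Z\<^sub>x = V\<inverse> (B - A) V Z\<close>, whose coefficient has size of order \<open>\<delta>\<close>. The mean value inequality bounds
  \<open>|Z - 1|\<close> by a small multiple of the maximum of \<open>|Z|\<close>, which in turn bounds this maximum. The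
  constant depends on the unperturbed system and on \<open>T\<close> alone.\<close>

lemma perturbation_bound:
  assumes T: "T > 0"
  obtains D where "D > 0"
    "\<And>B Y \<delta>. (\<And>x. (Y has_vector_derivative B x ** Y x) (at x)) \<Longrightarrow> Y 0 = mat 1 \<Longrightarrow>
       (\<And>x. x \<in> {0..T} \<Longrightarrow> norm (B x - A x) \<le> \<delta>) \<Longrightarrow> D * \<delta> \<le> 1 / 2 \<Longrightarrow>
       norm (Y T - V T) \<le> D * \<delta>"
proof -
  obtain K where K: "K > 0" "\<And>P Q. norm ((P :: complex^3^3) ** (Q :: complex^3^3)) \<le> norm P * norm Q * K"
    using mult3.pos_bounded by blast
  have K_mono: "norm (P ** Q) \<le> p * q * K" if "norm P \<le> p" "norm Q \<le> q" for P Q :: "complex^3^3" and p q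
  proof -
    have "norm P * norm Q \<le> p * q"
      using that order_trans[OF norm_ge_zero that(1)] by (intro mult_mono) simp_all
    then have "norm P * norm Q * K \<le> p * q * K"
      using K(1) by (intro mult_right_mono) simp_all
    with K(2)[of P Q] show ?thesis by linarith
  qed
  have "continuous_on {0..T} V" "continuous_on {0..T} V_inv"
    by (intro continuous_at_imp_continuous_on ballI has_vector_derivative_continuous[OF ode]
        has_vector_derivative_continuous[OF V_inv_ode])+
  then have "bounded (V ` {0..T} \<union> V_inv ` {0..T})"
    by (simp add: compact_continuous_image compact_imp_bounded)
  then obtain C where C: "C > 0" "\<And>x. x \<in> {0..T} \<Longrightarrow> norm (V x) \<le> C \<and> norm (V_inv x) \<le> C"
    unfolding bounded_pos by auto
  define I where "I = norm (mat 1 :: complex^3^3)"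
  define C1 where "C1 = C * K * (C * K) * K * T"
  \<comment> \<open>\<open>C1\<close> controls the growth of \<open>Z\<close>, and the second argument of \<open>max\<close> the resulting error in \<open>V Z\<close>,
    once \<open>|Z| \<le> 2 I\<close> is known.\<close>
  define D where "D = max C1 (C * K * (2 * C1 * I))"
  have C1: "C1 > 0" using C(1) K(1) T by (simp add: C1_def)
  then have "D > 0" by (simp add: D_def)
  moreover have "norm (Y T - V T) \<le> D * \<delta>"
    if Y: "\<And>x. (Y has_vector_derivative B x ** Y x) (at x)" and Y0: "Y 0 = mat 1"
      and \<delta>: "\<And>x. x \<in> {0..T} \<Longrightarrow> norm (B x - A x) \<le> \<delta>" and small: "D * \<delta> \<le> 1 / 2"
    for B Y \<delta>
  proof -
    have \<delta>0: "\<delta> \<ge> 0" using order_trans[OF norm_ge_zero \<delta>[of 0]] T by simp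
    define Z where "Z x = V_inv x ** Y x" for x
    have VZ: "Y x = V x ** Z x" for x by (simp add: Z_def matrix_mul_assoc V_V_inv)
    have Z0: "Z 0 = mat 1" using V_V_inv[of 0] by (simp add: Z_def init Y0)
    have Z': "(Z has_vector_derivative V_inv x ** (B x - A x) ** (V x ** Z x)) (at x)" for x
    proof -
      have "(Z has_vector_derivative V_inv x ** (B x ** Y x) + - (V_inv x ** A x) ** Y x) (at x)"
        unfolding Z_def by (rule mult3.has_vector_derivative[OF V_inv_ode[of x] Y[of x]])
      also have "V_inv x ** (B x ** Y x) + - (V_inv x ** A x) ** Y x = V_inv x ** (B x - A x) ** (V x ** Z x)"
        by (simp add: VZ[symmetric] mult3.minus_left mult3.diff_right mult3.diff_left matrix_mul_assoc)
      finally show ?thesis .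
    qed
    have "continuous_on {0..T} (\<lambda>x. norm (Z x))"
      by (intro continuous_on_norm continuous_at_imp_continuous_on ballI has_vector_derivative_continuous[OF Z'])
    then obtain s where s: "s \<in> {0..T}" "\<And>x. x \<in> {0..T} \<Longrightarrow> norm (Z x) \<le> norm (Z s)"
      using continuous_attains_sup[of "{0..T}" "\<lambda>x. norm (Z x)"] T by auto
    define m where "m = norm (Z s)"
    have Z'_bound: "norm (V_inv x ** (B x - A x) ** (V x ** Z x)) \<le> (C * \<delta> * K) * (C * m * K) * K"
      if "x \<in> {0..T}" for x
      using C(2)[OF that] \<delta>[OF that] s(2)[OF that] unfolding m_def by (intro K_mono) auto
    have "norm (Z x - mat 1) \<le> C1 * \<delta> * m" if x: "x \<in> {0..T}" for x
    proof -
      have "norm (Z x - Z 0) \<le> (C * \<delta> * K) * (C * m * K) * K * (x - 0)"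
        using x by (intro norm_increment_le[OF Z' Z'_bound]) auto
      also have "\<dots> \<le> (C * \<delta> * K) * (C * m * K) * K * T"
        using x C(1) K(1) \<delta>0 by (intro mult_left_mono) (auto simp: m_def)
      finally show ?thesis by (simp add: Z0 C1_def mult_ac)
    qed
    note step = this
    have C1D: "C1 * \<delta> \<le> 1 / 2"
      using small \<delta>0 mult_right_mono[of C1 D \<delta>] by (simp add: D_def)
    have "m \<le> I + C1 * \<delta> * m"
      using step[OF s(1)] norm_triangle_sub[of "Z s" "mat 1"] by (simp add: m_def I_def)
    moreover have "C1 * \<delta> * m \<le> 1 / 2 * m"
      using C1D by (intro mult_right_mono) (simp_all add: m_def)
    ultimately have "m \<le> 2 * I" by simp
    then have "C1 * \<delta> * m \<le> C1 * \<delta> * (2 * I)"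
      using C1 \<delta>0 by (intro mult_left_mono) auto
    with step[of T] T have ZT: "norm (Z T - mat 1) \<le> C1 * \<delta> * (2 * I)" by auto
    have "Y T - V T = V T ** (Z T - mat 1)"
      by (simp add: VZ mult3.diff_right)
    also have "norm \<dots> \<le> C * (C1 * \<delta> * (2 * I)) * K"
      using C(2)[of T] T ZT by (intro K_mono) auto
    also have "\<dots> \<le> D * \<delta>"
      using mult_right_mono[of "C * K * (2 * C1 * I)" D \<delta>] \<delta>0 by (simp add: D_def mult_ac)
    finally show ?thesis .
  qed
  ultimately show thesis by (rule that)
qed

end


section \<open>The characteristic polynomial of the monodromy matrix\<close>

text \<open>The entire functions \<open>g\<close> and \<open>cnj \<circ> g \<circ> cnj\<close> agree on the real axis, hence everywhere.\<close>

lemma schwarz_reflection_entire: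
  assumes hol: "g holomorphic_on UNIV" and real: "\<And>r :: real. g (of_real r) \<in> \<real>"
  shows "g (cnj z) = cnj (g z)"
proof -
  have "g z - cnj (g (cnj z)) = 0"
  proof (rule analytic_continuation[of "\<lambda>z. g z - cnj (g (cnj z))" UNIV \<real> 0])
    have "(cnj \<circ> g \<circ> cnj) holomorphic_on UNIV"
      using hol by (intro holomorphic_on_compose_cnj_cnj) auto
    then show "(\<lambda>z. g z - cnj (g (cnj z))) holomorphic_on UNIV"
      using hol by (intro holomorphic_intros) (simp_all add: o_def)
    show "(0 :: complex) islimpt \<real>"
      unfolding islimpt_approachable
    proof (intro allI impI)
      fix e :: real assume "e > 0"
      then have "complex_of_real (e / 2) \<in> \<real> \<and> complex_of_real (e / 2) \<noteq> 0 \<and> dist (complex_of_real (e / 2)) 0 < e"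
        by simp
      then show "\<exists>y\<in>\<real>. y \<noteq> (0 :: complex) \<and> dist y 0 < e" by blast
    qed
    show "g x - cnj (g (cnj x)) = 0" if "x \<in> \<real>" for x
    proof -
      from that obtain r where "x = of_real r" by (rule Reals_cases)
      with real[of r] show ?thesis by (simp add: Reals_cnj_iff)
    qed
  qed auto
  then show ?thesis by (metis complex_cnj_cnj right_minus_eq)
qed

definition cnj_mat :: "complex^'n^'m \<Rightarrow> complex^'n^'m" where
  "cnj_mat M = (\<chi> i j. cnj (M $ i $ j))"

lemma cnj_mat_mult: "cnj_mat (P ** Q) = cnj_mat P ** cnj_mat Q"
  by (simp add: cnj_mat_def vec_eq_iff matrix_matrix_mult_def)

lemma cnj_mat_one: "cnj_mat (mat 1) = mat 1"
  by (simp add: cnj_mat_def mat_def vec_eq_iff)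

lemma trace_cnj_mat: "trace (cnj_mat M) = cnj (trace M)"
  by (simp add: cnj_mat_def trace_def)

lemma bounded_linear_cnj_mat: "bounded_linear (cnj_mat :: complex^3^3 \<Rightarrow> complex^3^3)"
  by (intro linear_conv_bounded_linear[THEN iffD1] linearI) (simp_all add: cnj_mat_def vec_eq_iff)

lemma bounded_linear_transpose: "bounded_linear (transpose :: complex^3^3 \<Rightarrow> complex^3^3)"
  by (intro linear_conv_bounded_linear[THEN iffD1] linearI) (simp_all add: transpose_def vec_eq_iff)

text \<open>Multiplying the symmetry by the inverse transpose of \<open>M\<close> gives \<open>B N = (adj M)\<^sup>T B\<close>, so \<open>N\<close> is similar to
  the transposed inverse of \<open>M\<close>.\<close>

lemma trace_adjugate_of_symmetry:
  fixes M N B :: "complex^3^3"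
  assumes sym: "transpose M ** B ** N = B" and "det M = 1" and "invertible B"
  shows "trace (adjugate3 M) = trace N"
proof -
  obtain C where C: "B ** C = mat 1" "C ** B = mat 1"
    using \<open>invertible B\<close> by (auto simp: invertible_def)
  have "transpose (adjugate3 M) ** transpose M = mat 1"
    using adjugate3_inverse(1)[OF \<open>det M = 1\<close>] by (simp flip: matrix_transpose_mul)
  then have "B ** N = transpose (adjugate3 M) ** (transpose M ** B ** N)"
    by (simp add: matrix_mul_assoc)
  then have BN: "B ** N = transpose (adjugate3 M) ** B"
    by (simp add: sym)
  have "trace N = trace (C ** (B ** N))"
    by (simp add: matrix_mul_assoc C)
  also have "\<dots> = trace ((B ** N) ** C)"
    by (rule trace_mul_sym)
  also have "\<dots> = trace (transpose (adjugate3 M) ** (B ** C))"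
    by (simp add: BN matrix_mul_assoc)
  finally show ?thesis
    by (simp add: C trace_def transpose_def)
qed

locale hamiltonian_system =
  fixes T :: real and A V :: "real \<Rightarrow> complex \<Rightarrow> complex^3^3"
  assumes T_pos: "T > 0"
    and regular_periodic: "admissible_coefficients T A"
    and A1: "real_on_real_axis A"
    and A2: "hamiltonian_symmetry A"
    and trace_zero: "\<And>x l. trace (A x l) = 0"
    and V: "fundamental_solution A V"
begin

sublocale traceless_system "\<lambda>x. A x l" "\<lambda>x. V x l" for l
  using V trace_zero by unfold_locales (auto simp: fundamental_solution_def)

text \<open>On the compact set \<open>[0, T] \<times> cball l 1\<close> the coefficients are uniformly continuous, so a small change of
  the parameter is a uniformly small perturbation of the system.\<close>

lemma isCont_V: "isCont (V T) l"
proof -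
  obtain D where D: "D > 0" and near: "\<And>B Y \<delta>. (\<And>x. (Y has_vector_derivative B x ** Y x) (at x)) \<Longrightarrow>
      Y 0 = mat 1 \<Longrightarrow> (\<And>x. x \<in> {0..T} \<Longrightarrow> norm (B x - A x l) \<le> \<delta>) \<Longrightarrow> D * \<delta> \<le> 1 / 2 \<Longrightarrow>
      norm (Y T - V T l) \<le> D * \<delta>"
    using perturbation_bound[OF T_pos, of l] by blast
  have "continuous_on ({0..T} \<times> cball l 1) (\<lambda>(x, l). A x l)"
    using regular_periodic by (auto simp: admissible_coefficients_def intro: continuous_on_subset)
  then have unif: "uniformly_continuous_on ({0..T} \<times> cball l 1) (\<lambda>(x, l). A x l)"
    by (intro compact_uniformly_continuous compact_Times) auto
  show ?thesis
    unfolding continuous_at_eps_delta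
  proof (intro allI impI)
    fix e :: real assume "e > 0"
    define \<delta> where "\<delta> = min (1 / 2) (e / 2) / D"
    have \<delta>: "\<delta> > 0" "D * \<delta> \<le> 1 / 2" "D * \<delta> < e"
      using D \<open>e > 0\<close> by (auto simp: \<delta>_def)
    obtain d where d: "d > 0" "\<And>p q. p \<in> {0..T} \<times> cball l 1 \<Longrightarrow> q \<in> {0..T} \<times> cball l 1 \<Longrightarrow>
        dist q p < d \<Longrightarrow> dist (case q of (x, l) \<Rightarrow> A x l) (case p of (x, l) \<Rightarrow> A x l) < \<delta>"
      using unif \<delta>(1) unfolding uniformly_continuous_on_def by meson
    have "dist (V T k) (V T l) < e" if k: "dist k l < min d 1" for k
    proof -
      have "norm (A x k - A x l) \<le> \<delta>" if "x \<in> {0..T}" for x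
        using d(2)[of "(x, l)" "(x, k)"] that k by (auto simp: dist_Pair_Pair dist_norm norm_minus_commute)
      then have "norm (V T k - V T l) \<le> D * \<delta>"
        using ode init \<delta>(2) by (intro near) auto
      with \<delta>(3) show ?thesis by (simp add: dist_norm)
    qed
    then show "\<exists>d>0. \<forall>x'. dist x' l < d \<longrightarrow> dist (V T x') (V T l) < e"
      using d(1) by (intro exI[of _ "min d 1"]) auto
  qed
qed

text \<open>The conjugate of \<open>V(x, \<lambda>)\<close> solves the system at \<open>cnj \<lambda>\<close>.\<close>

lemma V_cnj: "V x (cnj l) = cnj_mat (V x l)"
proof -
  have A_cnj: "A x (cnj l) = cnj_mat (A x l)" for x
    using regular_periodic A1
    by (auto simp: vec_eq_iff cnj_mat_def admissible_coefficients_def real_on_real_axis_def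
        intro!: schwarz_reflection_entire)
  have "((\<lambda>x. cnj_mat (V x l)) has_vector_derivative A x (cnj l) ** cnj_mat (V x l)) (at x)" for x
    using bounded_linear.has_vector_derivative[OF bounded_linear_cnj_mat ode[of l x]]
    by (simp add: A_cnj cnj_mat_mult)
  from solution_eq[of "\<lambda>x. cnj_mat (V x l)" "cnj l", OF this, of x]
  show ?thesis by (simp add: init cnj_mat_one)
qed

text \<open>The two terms of the derivative of the left-hand side cancel by the assumption on \<open>B\<close>.\<close>

lemma symmetry_V:
  assumes B: "\<And>x l. transpose (A x l) ** B l = - (B l ** A x (- l))"
  shows "transpose (V x l) ** B l ** V x (- l) = B l"
proof -
  have "((\<lambda>x. transpose (V x l) ** B l ** V x (- l)) has_vector_derivative
      transpose (V x l) ** B l ** (A x (- l) ** V x (- l)) +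
      (transpose (V x l) ** 0 + transpose (A x l ** V x l) ** B l) ** V x (- l)) (at x)" for x
    by (rule mult3.has_vector_derivative[OF mult3.has_vector_derivative[OF
          bounded_linear.has_vector_derivative[OF bounded_linear_transpose ode[of l x]]
          has_vector_derivative_const] ode[of "- l" x]])
  moreover have "transpose (V x l) ** B l ** (A x (- l) ** V x (- l)) +
      (transpose (V x l) ** 0 + transpose (A x l ** V x l) ** B l) ** V x (- l) = 0" for x
  proof -
    have "transpose (A x l ** V x l) ** B l = transpose (V x l) ** (transpose (A x l) ** B l)"
      by (simp add: matrix_transpose_mul matrix_mul_assoc)
    then show ?thesis
      by (simp add: B mult3.minus_left mult3.minus_right mult3.zero_right matrix_mul_assoc)
  qed
  ultimately have "((\<lambda>x. transpose (V x l) ** B l ** V x (- l)) has_vector_derivative 0) (at x)" for x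
    by simp
  then have "transpose (V x l) ** B l ** V x (- l) = transpose (V 0 l) ** B l ** V 0 (- l)"
    by (rule constant_if_derivative_zero)
  then show ?thesis by (simp add: init transpose_mat)
qed

text \<open>Off the finite exceptional set the identity follows from the symmetry, because
  \<open>-\<lambda> = cnj \<lambda>\<close> on the imaginary axis. Both sides are continuous along this axis, and
  the complement of a finite set is dense.\<close>

theorem trace_adjugate_V:
  assumes "Re l = 0"
  shows "trace (adjugate3 (V T l)) = cnj (trace (V T l))"
proof -
  obtain B where B: "\<And>x l. transpose (A x l) ** B l = - (B l ** A x (- l))"
    and fin: "finite {l. \<not> invertible (B l)}"
    using A2 by (auto simp: hamiltonian_symmetry_def)
  \<comment> \<open>The defect of the identity along the imaginary axis, parametrized by the real number \<open>t\<close>.\<close>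
  define g where "g t = trace (adjugate3 (V T (\<i> * of_real t))) - cnj (trace (V T (\<i> * of_real t)))" for t :: real
  define F where "F = {t :: real. \<not> invertible (B (\<i> * of_real t))}"
  have "finite ((\<lambda>t :: real. \<i> * of_real t) -` {l. \<not> invertible (B l)})"
    using fin by (rule finite_vimageI) (simp add: inj_def)
  then have "finite F" by (simp add: F_def vimage_def)
  then have dense: "closure (- F) = UNIV"
    by (simp add: closure_complement empty_interior_finite)
  have g0: "g t = 0" if "t \<in> - F" for t
  proof -
    let ?l = "\<i> * of_real t :: complex"
    have "trace (adjugate3 (V T ?l)) = trace (V T (- ?l))"
      using that by (intro trace_adjugate_of_symmetry[OF symmetry_V[OF B]] det_V) (simp add: F_def)
    also have "V T (- ?l) = cnj_mat (V T ?l)"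
      using V_cnj[of T ?l] by simp
    finally show ?thesis by (simp add: g_def trace_cnj_mat)
  qed
  have "isCont g t" for t
  proof -
    have "isCont (\<lambda>t. V T (\<i> * of_real t)) t"
      by (rule isCont_o2[OF _ isCont_V]) (intro continuous_intros)
    then have "isCont (\<lambda>t. V T (\<i> * of_real t) $ i $ j) t" for i j
      by (intro continuous_component)
    then show ?thesis
      unfolding g_def trace_3 by (simp add: adjugate3_def)
  qed
  then have "continuous_on (closure (- F)) g"
    by (simp add: continuous_at_imp_continuous_on)
  from continuous_constant_on_closure[OF this g0, of "Im l"] have "g (Im l) = 0"
    by (simp add: dense)
  moreover have "\<i> * of_real (Im l) = l"
    using assms by (simp add: complex_eq_iff)
  ultimately show ?thesis by (simp add: g_def)
qed

theorem char_polynomial_monodromy: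
  assumes "Re l = 0"
  shows "char_polynomial (V T l) = reciprocal_cubic (trace (V T l))"
  unfolding char_polynomial_3 reciprocal_cubic_def trace_adjugate_V[OF assms] det_V ..

end


section \<open>Square-integrable functions up to null sets\<close>

lemma norm_vector_smult: "norm (c *s v) = cmod c * norm (v :: complex^'n)"
  by (simp add: norm_vec_def L2_set_right_distrib norm_mult)

lemma borel_measurable_vector_smult:
  fixes u :: "'a \<Rightarrow> complex^'n"
  assumes "u \<in> borel_measurable M"
  shows "(\<lambda>x. c *s u x) \<in> borel_measurable M"
proof -
  have "bounded_linear (\<lambda>v :: complex^'n. c *s v)"
    by (intro linear_conv_bounded_linear[THEN iffD1] linearI) (simp_all add: vec_eq_iff algebra_simps)
  then have "continuous_on UNIV (\<lambda>v :: complex^'n. c *s v)"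
    by (simp add: linear_continuous_on)
  from borel_measurable_continuous_on[OF this assms] show ?thesis .
qed

lemma L2_zero: "(\<lambda>_. 0) \<in> L2"
  by (simp add: L2_def)

lemma L2_combination:
  assumes u: "u \<in> L2" and v: "v \<in> L2"
  shows "(\<lambda>x. c *s u x + d *s v x) \<in> L2"
proof -
  have meas: "(\<lambda>x. c *s u x + d *s v x) \<in> borel_measurable lborel"
    using u v by (intro borel_measurable_add borel_measurable_vector_smult) (simp_all add: L2_def)
  have "integrable lborel (\<lambda>x. 2 * ((cmod c)\<^sup>2 * (norm (u x))\<^sup>2 + (cmod d)\<^sup>2 * (norm (v x))\<^sup>2))"
    using u v by (simp add: L2_def)
  then have "integrable lborel (\<lambda>x. (norm (c *s u x + d *s v x))\<^sup>2)"
  proof (rule Bochner_Integration.integrable_bound)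
    show "(\<lambda>x. (norm (c *s u x + d *s v x))\<^sup>2) \<in> borel_measurable lborel"
      using meas by measurable
    have "(norm (c *s u x + d *s v x))\<^sup>2 \<le> 2 * ((cmod c)\<^sup>2 * (norm (u x))\<^sup>2 + (cmod d)\<^sup>2 * (norm (v x))\<^sup>2)" for x
    proof -
      define p q where "p = cmod c * norm (u x)" and "q = cmod d * norm (v x)"
      have "norm (c *s u x + d *s v x) \<le> p + q"
        using norm_triangle_ineq[of "c *s u x" "d *s v x"] by (simp add: norm_vector_smult p_def q_def)
      then have "(norm (c *s u x + d *s v x))\<^sup>2 \<le> (p + q)\<^sup>2"
        by (intro power_mono) simp_all
      also have "\<dots> \<le> 2 * (p\<^sup>2 + q\<^sup>2)"
        using zero_le_power2[of "p - q"] by (simp add: power2_eq_square algebra_simps)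
      finally show ?thesis by (simp add: p_def q_def power_mult_distrib)
    qed
    then show "AE x in lborel. norm ((norm (c *s u x + d *s v x))\<^sup>2)
        \<le> norm (2 * ((cmod c)\<^sup>2 * (norm (u x))\<^sup>2 + (cmod d)\<^sup>2 * (norm (v x))\<^sup>2))"
      by (intro AE_I2) simp
  qed
  with meas show ?thesis by (simp add: L2_def)
qed

lemma L2_sum:
  assumes "\<And>i. i \<in> I \<Longrightarrow> f i \<in> L2"
  shows "(\<lambda>x. \<Sum>i\<in>I. c i *s f i x) \<in> L2"
  using assms
proof (induction I rule: infinite_finite_induct)
  case (insert i I)
  then have "(\<lambda>x. c i *s f i x + 1 *s (\<Sum>i\<in>I. c i *s f i x)) \<in> L2"
    by (intro L2_combination) simp_all
  with insert(1,2) show ?case by simp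
qed (simp_all add: L2_zero)

lemma ae_eq_refl: "ae_eq u u"
  by (simp add: ae_eq_def)

lemma ae_eq_sym: "ae_eq u v \<Longrightarrow> ae_eq v u"
  by (simp add: ae_eq_def eq_commute)

lemma ae_eq_trans [trans]: "ae_eq u v \<Longrightarrow> ae_eq v w \<Longrightarrow> ae_eq u w"
  unfolding ae_eq_def by (elim AE_mp) auto

lemma ae_eq_combination:
  assumes "ae_eq u u'" "ae_eq v v'"
  shows "ae_eq (\<lambda>x. c *s u x + d *s v x) (\<lambda>x. c *s u' x + d *s v' x)"
  using assms unfolding ae_eq_def by eventually_elim simp

lemma L2_linear_combination:
  assumes "L2_linear_on L2 F" "u \<in> L2" "v \<in> L2"
  shows "ae_eq (F (\<lambda>x. c *s u x + d *s v x)) (\<lambda>x. c *s F u x + d *s F v x)"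
  using assms unfolding L2_linear_on_def by blast

lemma L2_linear_cong:
  assumes "L2_linear_on L2 F" "u \<in> L2" "v \<in> L2" "ae_eq u v"
  shows "ae_eq (F u) (F v)"
  using assms unfolding L2_linear_on_def by blast

lemma L2_linear_sum:
  assumes F: "L2_linear_on L2 F" and "finite I" "\<And>i. i \<in> I \<Longrightarrow> f i \<in> L2"
  shows "ae_eq (F (\<lambda>x. \<Sum>i\<in>I. c i *s f i x)) (\<lambda>x. \<Sum>i\<in>I. c i *s F (f i) x)"
  using assms(2,3)
proof (induction I rule: finite_induct)
  case empty
  show ?case using L2_linear_combination[OF F L2_zero L2_zero, of 0 0] by simp
next
  case (insert i I)
  have fi: "f i \<in> L2" and fI: "(\<lambda>x. \<Sum>i\<in>I. c i *s f i x) \<in> L2"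
    using insert by (auto intro: L2_sum)
  have "ae_eq (F (\<lambda>x. c i *s f i x + 1 *s (\<Sum>i\<in>I. c i *s f i x)))
      (\<lambda>x. c i *s F (f i) x + 1 *s F (\<lambda>x. \<Sum>i\<in>I. c i *s f i x) x)"
    by (rule L2_linear_combination[OF F fi fI])
  also have "ae_eq \<dots> (\<lambda>x. c i *s F (f i) x + 1 *s (\<Sum>i\<in>I. c i *s F (f i) x))"
    using insert by (intro ae_eq_combination ae_eq_refl) auto
  finally show ?case
    using insert(1,2) by simp
qed

text \<open>The integral of \<open>|U|\<^sup>2\<close> would be at least \<open>n \<epsilon>\<^sup>2\<close> for every \<open>n\<close>.\<close>

lemma not_L2_if_bounded_below:
  assumes U: "U \<in> L2" and "\<epsilon> > 0" and below: "\<And>x. x \<ge> X \<Longrightarrow> \<epsilon> \<le> norm (U x)"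
  shows False
proof -
  have int: "integrable lborel (\<lambda>x. (norm (U x))\<^sup>2)"
    using U by (simp add: L2_def)
  have "real n * \<epsilon>\<^sup>2 \<le> (LINT x|lborel. (norm (U x))\<^sup>2)" for n
  proof -
    have "real n * \<epsilon>\<^sup>2 = (LINT x|lborel. indicator {X..X + real n} x * \<epsilon>\<^sup>2)"
      by (simp add: mult.commute)
    also have "\<dots> \<le> (LINT x|lborel. (norm (U x))\<^sup>2)"
    proof (rule integral_mono[OF _ int])
      show "integrable lborel (\<lambda>x. indicator {X..X + real n} x * \<epsilon>\<^sup>2)"
        by (intro integrable_mult_left integrable_real_indicator) simp_all
      show "indicator {X..X + real n} x * \<epsilon>\<^sup>2 \<le> (norm (U x))\<^sup>2" for x
        using below[of x] \<open>\<epsilon> > 0\<close> by (auto simp: indicator_def intro!: power_mono)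
    qed
    finally show ?thesis .
  qed
  moreover obtain n where "(LINT x|lborel. (norm (U x))\<^sup>2) < real n * \<epsilon>\<^sup>2"
    using reals_Archimedean3[of "\<epsilon>\<^sup>2"] \<open>\<epsilon> > 0\<close> by auto
  ultimately show False by (meson not_less)
qed


section \<open>From the operator to the first-order system\<close>

lemma system_graph_combination:
  fixes A :: "real \<Rightarrow> complex \<Rightarrow> complex^'k^'k"
  assumes "(u, g) \<in> system_graph A l" "(v, h) \<in> system_graph A l"
  shows "(\<lambda>x. c *s u x + d *s v x, \<lambda>x. c *s g x + d *s h x) \<in> system_graph A l"
proof -
  have lin: "bounded_linear (\<lambda>v :: complex^'k. c *s v)" for c
    by (intro linear_conv_bounded_linear[THEN iffD1] linearI) (simp_all add: vec_eq_iff algebra_simps)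
  have "((\<lambda>x. A x l *v (c *s u x + d *s v x) + (c *s g x + d *s h x)) has_integral
      (c *s u b + d *s v b) - (c *s u a + d *s v a)) {a..b}" if "a \<le> b" for a b
  proof -
    have "((\<lambda>x. A x l *v u x + g x) has_integral (u b - u a)) {a..b}"
      and "((\<lambda>x. A x l *v v x + h x) has_integral (v b - v a)) {a..b}"
      using assms that by (auto simp: system_graph_def)
    note this[THEN has_integral_linear]
    from has_integral_add[OF this(1)[OF lin[of c]] this(2)[OF lin[of d]]]
    have "((\<lambda>x. c *s (A x l *v u x + g x) + d *s (A x l *v v x + h x)) has_integral
        c *s (u b - u a) + d *s (v b - v a)) {a..b}"
      by (simp only: o_def)
    then show ?thesis
      by (simp add: matrix_vector_right_distrib vector_scalar_commute vector_add_ldistrib vector_ssub_ldistrib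
          algebra_simps)
  qed
  then show ?thesis
    using assms by (auto simp: system_graph_def intro: L2_combination)
qed

lemma system_graph_sum:
  fixes A :: "real \<Rightarrow> complex \<Rightarrow> complex^'k^'k"
  assumes "finite I" "\<And>i. i \<in> I \<Longrightarrow> (u i, g i) \<in> system_graph A l"
  shows "(\<lambda>x. \<Sum>i\<in>I. c i *s u i x, \<lambda>x. \<Sum>i\<in>I. c i *s g i x) \<in> system_graph A l"
  using assms
proof (induction I rule: finite_induct)
  case empty
  show ?case by (simp add: system_graph_def L2_zero)
next
  case (insert i I)
  then have "(\<lambda>x. c i *s u i x + 1 *s (\<Sum>i\<in>I. c i *s u i x), \<lambda>x. c i *s g i x + 1 *s (\<Sum>i\<in>I. c i *s g i x))
      \<in> system_graph A l"
    by (intro system_graph_combination) auto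
  with insert(1,2) show ?case by simp
qed

text \<open>The graph of an adjoint lies in \<open>L\<^sup>2 \<times> L\<^sup>2\<close>, and both \<open>L\<close> and, up to a sign, \<open>J\<close> are adjoints.\<close>

lemma hamiltonian_problem_subset_L2:
  assumes "hamiltonian_problem T J L"
  shows "L O J \<subseteq> L2 \<times> L2"
proof -
  have "L \<subseteq> L2 \<times> L2"
    using assms by (auto simp: hamiltonian_problem_def L2_adjoint_def)
  moreover have "z \<in> L2" if "(y, z) \<in> J" for y z
  proof -
    have J: "L2_adjoint J = {(u, z). (u, \<lambda>x. - z x) \<in> J}"
      using assms by (simp add: hamiltonian_problem_def)
    have "(y, \<lambda>x. - z x) \<in> L2_adjoint J"
      using that by (simp add: J)
    then have "(\<lambda>x. - z x) \<in> L2" by (simp add: L2_adjoint_def)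
    from L2_combination[OF this L2_zero, of "-1" 0] show "z \<in> L2" by simp
  qed
  ultimately show ?thesis by blast
qed

text \<open>Every \<open>h\<close> is \<open>b g\<close> modulo the range of the system, and \<open>g\<close> is an element of the range of \<open>\<lambda> - P\<close>
  modulo a finite-dimensional space, spanned by \<open>S\<close>. The map \<open>b\<close> takes the range of \<open>\<lambda> - P\<close> into that of the
  system, so every \<open>h\<close> is a combination of the images of the elements of \<open>S\<close> modulo the range of the system.\<close>

lemma system_range_finite_codimension:
  fixes P :: "(real \<Rightarrow> complex^'n) rel" and A :: "real \<Rightarrow> complex \<Rightarrow> complex^'k^'k"
  assumes P: "P \<subseteq> L2 \<times> L2" and reform: "first_order_reformulation P A"
    and codim: "finite_dim_mod (L2_range (shifted_graph P l)) L2"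
  obtains S :: "(real \<Rightarrow> complex^'n) set" and e where "finite S" "\<And>s. s \<in> S \<Longrightarrow> e s \<in> L2"
    "\<And>h. h \<in> L2 \<Longrightarrow> \<exists>u k c. (u, k) \<in> system_graph A l \<and> ae_eq h (\<lambda>x. k x + (\<Sum>s\<in>S. c s *s e s x))"
proof -
  obtain a b where b: "L2_linear_on L2 b" "b ` L2 \<subseteq> L2"
    and ab: "\<And>v g. (v, g) \<in> shifted_graph P l \<Longrightarrow> (a v, b g) \<in> system_graph A l"
    and reduce: "\<And>h. h \<in> L2 \<Longrightarrow> \<exists>g\<in>L2. \<exists>u. (u, \<lambda>x. h x - b g x) \<in> system_graph A l"
    using spec[OF reform[unfolded first_order_reformulation_def], of l]
    by (elim exE conjE) (rule that, assumption+, fast+)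
  obtain S where S: "finite S" "S \<subseteq> L2"
    and span: "\<And>g. g \<in> L2 \<Longrightarrow> \<exists>n\<in>L2_range (shifted_graph P l). \<exists>c. ae_eq g (\<lambda>x. n x + (\<Sum>s\<in>S. c s *s s x))"
    using codim unfolding finite_dim_mod_def by blast
  have "\<exists>u k c. (u, k) \<in> system_graph A l \<and> ae_eq h (\<lambda>x. k x + (\<Sum>s\<in>S. c s *s b s x))"
    if h: "h \<in> L2" for h
  proof -
    obtain g u where g: "g \<in> L2" and u: "(u, \<lambda>x. h x - b g x) \<in> system_graph A l"
      using reduce[OF h] by blast
    obtain n c where n: "n \<in> L2_range (shifted_graph P l)"
      and gn: "ae_eq g (\<lambda>x. n x + (\<Sum>s\<in>S. c s *s s x))"
      using span[OF g] by blast
    obtain v w where vw: "(v, w) \<in> shifted_graph P l" and wn: "ae_eq w n" and nL2: "n \<in> L2"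
      using n by (auto simp: L2_range_def)
    have w: "w \<in> L2"
    proof -
      obtain p where "(v, p) \<in> P" and wp: "w = (\<lambda>x. l *s v x - p x)"
        using vw by (auto simp: shifted_graph_def)
      then have "v \<in> L2" "p \<in> L2" using P by auto
      from L2_combination[OF this, of l "-1"] show ?thesis by (simp add: wp)
    qed
    define \<sigma> where "\<sigma> = (\<lambda>x. \<Sum>s\<in>S. c s *s s x)"
    have \<sigma>: "\<sigma> \<in> L2"
      using S by (auto simp: \<sigma>_def intro: L2_sum)
    have "ae_eq (b g) (b (\<lambda>x. 1 *s n x + 1 *s \<sigma> x))"
      using gn by (intro L2_linear_cong[OF b(1)] g L2_combination nL2 \<sigma>) (simp add: \<sigma>_def)
    also have "ae_eq \<dots> (\<lambda>x. 1 *s b n x + 1 *s b \<sigma> x)"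
      by (rule L2_linear_combination[OF b(1) nL2 \<sigma>])
    also have "ae_eq \<dots> (\<lambda>x. 1 *s b w x + 1 *s (\<Sum>s\<in>S. c s *s b s x))"
      using S unfolding \<sigma>_def
      by (intro ae_eq_combination L2_linear_cong[OF b(1) nL2 w ae_eq_sym[OF wn]] L2_linear_sum[OF b(1)]) auto
    finally have bg: "ae_eq (b g) (\<lambda>x. b w x + (\<Sum>s\<in>S. c s *s b s x))"
      by simp
    have "(\<lambda>x. 1 *s u x + 1 *s a v x, \<lambda>x. 1 *s (h x - b g x) + 1 *s b w x) \<in> system_graph A l"
      by (rule system_graph_combination[OF u ab[OF vw]])
    moreover have "ae_eq h (\<lambda>x. (1 *s (h x - b g x) + 1 *s b w x) + (\<Sum>s\<in>S. c s *s b s x))"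
      using bg unfolding ae_eq_def by eventually_elim simp
    ultimately show ?thesis by blast
  qed
  then show thesis
    using that[OF S(1)] S(2) b(2) by blast
qed


section \<open>Infinite codimension of the range\<close>

text \<open>A homogeneous linear system with more unknowns than equations has a nontrivial solution.
  Gaussian elimination: each step removes one equation together with one unknown, the pivot.\<close>

lemma nontrivial_relation:
  fixes c :: "'j \<Rightarrow> 'i \<Rightarrow> 'a::field"
  assumes "finite I" "finite J" "card I < card J"
  shows "\<exists>d. (\<exists>j\<in>J. d j \<noteq> 0) \<and> (\<forall>i\<in>I. (\<Sum>j\<in>J. d j * c j i) = 0)"
  using assms
proof (induction I arbitrary: J c rule: finite_induct)
  case empty
  then obtain j where "j \<in> J" by (auto simp: card_gt_0_iff)
  then show ?case by (intro exI[of _ "\<lambda>_. 1"]) auto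
next
  case (insert k I)
  show ?case
  proof (cases "\<forall>j\<in>J. c j k = 0")
    case True
    with insert.IH[of J c] insert.prems insert.hyps show ?thesis by auto
  next
    case False
    then obtain p where p: "p \<in> J" "c p k \<noteq> 0" by blast
    define c' where "c' j i = c j i - c j k / c p k * c p i" for j i
    have "card I < card (J - {p})"
      using insert.prems insert.hyps p by simp
    then obtain d where d: "\<exists>j\<in>J - {p}. d j \<noteq> 0" "\<forall>i\<in>I. (\<Sum>j\<in>J - {p}. d j * c' j i) = 0"
      using insert.IH[of "J - {p}" c'] insert.prems by auto
    \<comment> \<open>Back substitution: the coefficient of the pivot \<open>p\<close> is the one that solves equation \<open>k\<close>.\<close>
    define e where "e = d(p := - (\<Sum>j\<in>J - {p}. d j * c j k) / c p k)"
    have e_sum: "(\<Sum>j\<in>J. e j * c j i) = (\<Sum>j\<in>J - {p}. d j * c' j i)" for i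
    proof -
      have "(\<Sum>j\<in>J. e j * c j i) = e p * c p i + (\<Sum>j\<in>J - {p}. e j * c j i)"
        using insert.prems p by (simp add: sum.remove)
      also have "(\<Sum>j\<in>J - {p}. e j * c j i) = (\<Sum>j\<in>J - {p}. d j * c j i)"
        by (rule sum.cong) (simp_all add: e_def)
      also have "e p * c p i = - (\<Sum>j\<in>J - {p}. d j * c j k) * (c p i / c p k)"
        by (simp add: e_def)
      also have "- (\<Sum>j\<in>J - {p}. d j * c j k) * (c p i / c p k) + (\<Sum>j\<in>J - {p}. d j * c j i)
          = (\<Sum>j\<in>J - {p}. d j * c j i - d j * c j k * (c p i / c p k))"
        unfolding sum_subtractf sum_distrib_right[symmetric] by simp
      also have "\<dots> = (\<Sum>j\<in>J - {p}. d j * c' j i)"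
        by (rule sum.cong) (simp_all add: c'_def right_diff_distrib)
      finally show ?thesis .
    qed
    have "(\<Sum>j\<in>J - {p}. d j * c' j k) = 0"
      using p by (simp add: c'_def)
    with d(2) have "\<forall>i\<in>insert k I. (\<Sum>j\<in>J. e j * c j i) = 0"
      by (simp add: e_sum)
    moreover have "\<exists>j\<in>J. e j \<noteq> 0"
      using d(1) by (auto simp: e_def)
    ultimately show ?thesis by blast
  qed
qed

text \<open>Any infinite family of distinct exponents in \<open>(0, 1/2)\<close> serves the purpose: \<open>(1 + x)\<^sup>t\<close> is
  unbounded for \<open>t > 0\<close>, and its derivative is square-integrable for \<open>t < 1/2\<close>.\<close>

definition growth_exponent :: "nat \<Rightarrow> real" where
  "growth_exponent j = 1 / (real j + 3)"

lemma growth_exponent_bounds: "0 < growth_exponent j" "growth_exponent j \<le> 1 / 3"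
  by (simp_all add: growth_exponent_def field_simps)

lemma growth_exponent_strict_antimono: "i < j \<Longrightarrow> growth_exponent j < growth_exponent i"
  by (simp add: growth_exponent_def field_simps)

text \<open>The power with the largest exponent, that is, with the least index \<open>m\<close> of a nonzero coefficient, dominates:
  divided by it, the sum tends to \<open>d m\<close>.\<close>

lemma powers_combination_bounded_below:
  fixes d :: "nat \<Rightarrow> complex"
  assumes "finite J" and "\<exists>j\<in>J. d j \<noteq> 0"
  obtains \<epsilon> X where "\<epsilon> > 0" "X \<ge> 0"
    "\<And>x. x \<ge> X \<Longrightarrow> \<epsilon> \<le> cmod (c + (\<Sum>j\<in>J. d j * of_real ((1 + x) powr growth_exponent j)))"
proof -
  define m where "m = Min {j \<in> J. d j \<noteq> 0}"
  have m: "m \<in> J" "d m \<noteq> 0" and least: "\<And>j. j \<in> J \<Longrightarrow> d j \<noteq> 0 \<Longrightarrow> m \<le> j"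
    using Min_in[of "{j \<in> J. d j \<noteq> 0}"] assms by (auto simp: m_def)
  let ?F = "\<lambda>x. c + (\<Sum>j\<in>J. d j * of_real ((1 + x) powr growth_exponent j))"
  let ?t = "growth_exponent m"
  have shift: "filterlim (\<lambda>x :: real. 1 + x) at_top at_top"
    by (intro filterlim_tendsto_add_at_top[OF tendsto_const filterlim_ident])
  have decay: "((\<lambda>x. complex_of_real ((1 + x) powr s)) \<longlongrightarrow> 0) at_top" if "s < 0" for s
    using tendsto_of_real[OF tendsto_neg_powr[OF that shift], where 'a = complex] by simp
  have summand: "((\<lambda>x. d j * of_real ((1 + x) powr (growth_exponent j - ?t))) \<longlongrightarrow> (if j = m then d m else 0)) at_top"
    if "j \<in> J" for j
  proof (cases "j = m \<or> d j = 0")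
    case True
    moreover have "\<forall>\<^sub>F x :: real in at_top. 1 + x \<noteq> 0"
      using eventually_ge_at_top[of 0] by eventually_elim simp
    ultimately show ?thesis
      by (intro tendsto_eventually) (auto elim!: eventually_mono)
  next
    case False
    then have "growth_exponent j - ?t < 0"
      using least[OF that] growth_exponent_strict_antimono[of m j] by simp
    from tendsto_mult_left[OF decay[OF this], of "d j"] False show ?thesis by simp
  qed
  have "((\<lambda>x. c * of_real ((1 + x) powr (- ?t)) + (\<Sum>j\<in>J. d j * of_real ((1 + x) powr (growth_exponent j - ?t))))
      \<longlongrightarrow> c * 0 + (\<Sum>j\<in>J. if j = m then d m else 0)) at_top"
    using growth_exponent_bounds by (intro tendsto_intros decay summand) auto
  moreover have "c * 0 + (\<Sum>j\<in>J. if j = m then d m else 0) = d m"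
    using m \<open>finite J\<close> by simp
  moreover have "\<forall>\<^sub>F x in at_top. c * of_real ((1 + x) powr (- ?t)) +
      (\<Sum>j\<in>J. d j * of_real ((1 + x) powr (growth_exponent j - ?t))) = ?F x * of_real ((1 + x) powr (- ?t))"
    using eventually_ge_at_top[of 0]
  proof eventually_elim
    case (elim x)
    have "(1 + x) powr (s - ?t) = (1 + x) powr s * (1 + x) powr (- ?t)" for s
      by (simp flip: powr_add)
    then show ?case
      by (simp only: distrib_right sum_distrib_right of_real_mult mult.assoc)
  qed
  ultimately have "((\<lambda>x. ?F x * of_real ((1 + x) powr (- ?t))) \<longlongrightarrow> d m) at_top"
    by (simp add: tendsto_cong)
  then have "\<forall>\<^sub>F x in at_top. cmod (d m) / 2 < cmod (?F x * of_real ((1 + x) powr (- ?t)))"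
    using m(2) by (intro order_tendstoD(1)[OF tendsto_norm]) auto
  moreover have "\<forall>\<^sub>F x in at_top. cmod (?F x * of_real ((1 + x) powr (- ?t))) \<le> cmod (?F x)"
    using eventually_ge_at_top[of 0]
  proof eventually_elim
    case (elim x)
    have "(1 + x) powr (- ?t) \<le> 1 powr (- ?t)"
      using elim growth_exponent_bounds(1)[of m] by (intro powr_mono2') auto
    then show ?case
      by (simp add: norm_mult mult_left_le)
  qed
  ultimately have "\<forall>\<^sub>F x in at_top. cmod (d m) / 2 \<le> cmod (?F x)"
    by eventually_elim linarith
  then obtain X where "\<And>x. x \<ge> X \<Longrightarrow> cmod (d m) / 2 \<le> cmod (?F x)"
    by (auto simp: eventually_at_top_linorder)
  then show thesis
    using that[of "cmod (d m) / 2" "max X 0"] m(2) by auto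
qed

lemma integrable_power_decay:
  fixes p :: real
  assumes "p > 1"
  shows "integrable lborel (\<lambda>x::real. indicator {0..} x * (1 + x) powr - p)"
proof -
  have meas: "(\<lambda>x :: real. (1 + x) powr - p) \<in> borel_measurable borel"
    by measurable
  have "(\<integral>\<^sup>+ x. ennreal ((1 + x) powr - p) * indicator {0..} x \<partial>lborel) = 0 - (1 + 0) powr (1 - p) / (1 - p)"
  proof (rule nn_integral_FTC_atLeast[OF meas])
    show "((\<lambda>x. (1 + x) powr (1 - p) / (1 - p)) has_field_derivative (1 + x) powr - p) (at x)" if "0 \<le> x" for x
      using that assms by (auto intro!: derivative_eq_intros)
    have "filterlim (\<lambda>x :: real. 1 + x) at_top at_top"
      by (intro filterlim_tendsto_add_at_top[OF tendsto_const filterlim_ident])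
    then have "((\<lambda>x. (1 + x) powr (1 - p)) \<longlongrightarrow> 0) at_top"
      using assms by (intro tendsto_neg_powr) auto
    then show "((\<lambda>x. (1 + x) powr (1 - p) / (1 - p)) \<longlongrightarrow> 0) at_top"
      by (rule tendsto_divide_zero)
  qed simp
  then have "(\<integral>\<^sup>+ x. ennreal (indicator {0..} x * (1 + x) powr - p) \<partial>lborel) < \<infinity>"
    by (simp add: ennreal_mult' mult.commute ennreal_indicator)
  then show ?thesis
    by (intro integrableI_nonneg) (auto simp: less_top)
qed

text \<open>The bilinear pairing, without conjugation, which matches the non-conjugated transpose.\<close>

definition dot :: "complex^3 \<Rightarrow> complex^3 \<Rightarrow> complex" where
  "dot w u = (\<Sum>i\<in>UNIV. w $ i * u $ i)"

lemma bilinear_dot: "bilinear dot"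
  unfolding bilinear_def linear_iff
  by (simp add: dot_def sum.distrib scaleR_sum_right algebra_simps)

interpretation dot: bounded_bilinear dot
  using bilinear_dot by (simp only: bilinear_conv_bounded_bilinear)

lemma bilinear_row_mult: "bilinear ((v*) :: complex^3 \<Rightarrow> complex^3^3 \<Rightarrow> complex^3)"
  unfolding bilinear_def linear_iff
  by (simp add: vec_eq_iff vector_matrix_mult_def sum.distrib scaleR_sum_right algebra_simps)

interpretation row_mult: bounded_bilinear "(v*) :: complex^3 \<Rightarrow> complex^3^3 \<Rightarrow> complex^3"
  using bilinear_row_mult by (simp only: bilinear_conv_bounded_bilinear)

lemma bilinear_col_mult: "bilinear ((*v) :: complex^3^3 \<Rightarrow> complex^3 \<Rightarrow> complex^3)"
  unfolding bilinear_def linear_iff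
  by (simp add: vec_eq_iff matrix_vector_mult_def sum.distrib scaleR_sum_right algebra_simps)

interpretation col_mult: bounded_bilinear "(*v) :: complex^3^3 \<Rightarrow> complex^3 \<Rightarrow> complex^3"
  using bilinear_col_mult by (simp only: bilinear_conv_bounded_bilinear)

lemma dot_row_mult: "dot (w v* A) u = dot w (A *v u)"
  by (simp add: dot_def vector_matrix_mult_def matrix_vector_mult_def sum_3 algebra_simps)

lemma dot_smult: "dot w (c *s u) = c * dot w u"
  by (simp add: dot_def sum_distrib_left mult_ac)

lemma dot_cnj: "dot w (\<chi> i. cnj (w $ i)) = of_real ((norm w)\<^sup>2)"
proof -
  have "(norm w)\<^sup>2 = (\<Sum>i\<in>UNIV. (cmod (w $ i))\<^sup>2)"
    by (simp add: norm_vec_def L2_set_def sum_nonneg)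
  then show ?thesis
    by (simp only: dot_def vec_lambda_beta complex_norm_square[symmetric] of_real_sum)
qed

context hamiltonian_system
begin

text \<open>For a left eigenvector \<open>\<rho>\<close> of the monodromy matrix, \<open>w = \<rho> V\<inverse>\<close> solves the adjoint
  system and satisfies \<open>w(x) = \<mu> w(x + T)\<close>. So \<open>|w|\<close> is \<open>T\<close>-periodic, and its bounds are
  those on \<open>[0, T]\<close>, where it is continuous and positive.\<close>

lemma bounded_adjoint_solution:
  assumes "\<mu> \<in> circle_eigenvalues (V T l)"
  obtains w p q where "\<And>x. (w has_vector_derivative - (w x v* A x l)) (at x)" "\<And>x. w x \<noteq> 0"
    "p > 0" "\<And>x. x \<ge> 0 \<Longrightarrow> p \<le> norm (w x) \<and> norm (w x) \<le> q"
proof -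
  have mu: "det (mat \<mu> - V T l) = 0" "cmod \<mu> = 1"
    using assms by (auto simp: circle_eigenvalues_def eigenvalues_eq_roots poly_char_polynomial_3)
  have "transpose (mat \<mu> - V T l) = mat \<mu> - transpose (V T l)"
    by (simp add: vec_eq_iff transpose_def mat_def)
  then have "poly (char_polynomial (transpose (V T l))) \<mu> = 0"
    using mu(1) by (metis det_transpose poly_char_polynomial_3)
  then have "\<mu> \<in> eigenvalues (transpose (V T l))"
    by (simp add: eigenvalues_eq_roots)
  then obtain \<rho> where \<rho>: "\<rho> \<noteq> 0" "\<rho> v* V T l = \<mu> *s \<rho>"
    by (auto simp: eigenvalues_def)
  define w where "w x = \<rho> v* V_inv l x" for x
  have w': "(w has_vector_derivative - (w x v* A x l)) (at x)" for x
  proof -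
    have "(w has_vector_derivative \<rho> v* (- (V_inv l x ** A x l)) + 0 v* V_inv l x) (at x)"
      unfolding w_def by (rule row_mult.has_vector_derivative[OF has_vector_derivative_const V_inv_ode])
    then show ?thesis
      by (simp add: row_mult.minus_right w_def vector_matrix_mul_assoc)
  qed
  have wV: "w x v* V x l = \<rho>" for x
    by (simp add: w_def vector_matrix_mul_assoc V_inv_V)
  have w0: "w x \<noteq> 0" for x
    using wV[of x] \<rho>(1) by auto
  have shift: "norm (w (x + T)) = norm (w x)" for x
  proof -
    have per: "A (x + T) l = A x l" for x
      using regular_periodic by (simp add: admissible_coefficients_def)
    have "w x v* V (x + T) l = w x v* V x l v* V T l"
      by (simp only: floquet[OF per] vector_matrix_mul_assoc)
    also have "\<dots> = (\<mu> *s w (x + T)) v* V (x + T) l"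
      by (simp only: scalar_vector_matrix_assoc wV \<rho>)
    finally have "((\<mu> *s w (x + T)) v* V (x + T) l) v* V_inv l (x + T) = (w x v* V (x + T) l) v* V_inv l (x + T)"
      by simp
    then have "\<mu> *s w (x + T) = w x"
      by (simp only: vector_matrix_mul_assoc V_V_inv vector_matrix_mul_rid)
    then show ?thesis
      using norm_vector_smult[of \<mu> "w (x + T)"] mu(2) by simp
  qed
  have shift_n: "norm (w (x + real n * T)) = norm (w x)" for x n
  proof (induction n)
    case (Suc n)
    have "x + real (Suc n) * T = (x + real n * T) + T" by (simp add: algebra_simps)
    with shift[of "x + real n * T"] Suc show ?case by (simp only:)
  qed simp
  have cont: "continuous_on {0..T} (\<lambda>x. norm (w x))"
    by (intro continuous_on_norm continuous_at_imp_continuous_on ballI has_vector_derivative_continuous[OF w'])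
  have ne: "{0..T} \<noteq> {}" using T_pos by simp
  obtain s where s: "\<And>x. x \<in> {0..T} \<Longrightarrow> norm (w s) \<le> norm (w x)"
    using continuous_attains_inf[OF compact_Icc ne cont] by blast
  obtain t where t: "\<And>x. x \<in> {0..T} \<Longrightarrow> norm (w x) \<le> norm (w t)"
    using continuous_attains_sup[OF compact_Icc ne cont] by blast
  have "norm (w s) \<le> norm (w x) \<and> norm (w x) \<le> norm (w t)" if "x \<ge> 0" for x
  proof -
    define n where "n = nat \<lfloor>x / T\<rfloor>"
    have "real n \<le> x / T" "x / T < real n + 1"
      using that T_pos by (auto simp: n_def)
    then have "x - real n * T \<in> {0..T}"
      using T_pos by (auto simp: field_simps)
    with s t shift_n[of "x - real n * T" n] show ?thesis by fastforce
  qed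
  with that[OF w' w0, of "norm (w s)" "norm (w t)"] w0 show thesis by simp
qed

text \<open>An \<open>L\<^sup>2\<close> inhomogeneity need only give an absolutely continuous solution. If it agrees almost
  everywhere with a continuous function, the fundamental theorem of calculus yields a derivative at every point.\<close>

lemma solution_differentiable:
  assumes sol: "(u, k) \<in> system_graph A l" and kh: "ae_eq k h"
    and cont: "continuous_on {0..X} h" and x: "x \<in> {0..X}"
  shows "(u has_vector_derivative A x l *v u x + h x) (at x within {0..X})"
proof -
  let ?f = "\<lambda>x. A x l *v u x + h x"
  have int: "(?f has_integral (u b - u a)) {a..b}" if "a \<le> b" for a b
  proof -
    have "((\<lambda>x. A x l *v u x + k x) has_integral (u b - u a)) {a..b}"
      using sol that by (auto simp: system_graph_def)
    moreover have ae: "AE x in lborel. x \<in> {a..b} \<longrightarrow> A x l *v u x + k x = ?f x"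
      using kh unfolding ae_eq_def by eventually_elim simp
    ultimately show ?thesis
      by (simp only: has_integral_AE[OF ae])
  qed
  have u: "u b = u 0 + integral {0..b} ?f" if "0 \<le> b" for b
    using integral_unique[OF int[OF that]] by simp
  have "continuous_on {0..X} (\<lambda>b. u 0 + integral {0..b} ?f)"
    using int[of 0 X] x
    by (intro continuous_intros indefinite_integral_continuous_1) (auto simp: integrable_on_def)
  then have cont_u: "continuous_on {0..X} u"
    by (rule iffD1[OF continuous_on_cong[OF refl], rotated]) (rule u[symmetric], simp)
  have "continuous_on UNIV (\<lambda>x. (\<lambda>(x, lam). A x lam) (x, l))"
    using regular_periodic
    by (intro continuous_on_compose2[of UNIV "\<lambda>(x, lam). A x lam" UNIV "\<lambda>x. (x, l)"])
      (auto simp: admissible_coefficients_def intro!: continuous_intros)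
  then have "continuous_on {0..X} (\<lambda>x. A x l)"
    by (auto intro: continuous_on_subset)
  then have "continuous_on {0..X} ?f"
    by (intro continuous_on_add cont col_mult.continuous_on cont_u)
  from integral_has_vector_derivative[OF this x]
  have "((\<lambda>b. u 0 + integral {0..b} ?f) has_vector_derivative ?f x) (at x within {0..X})"
    by (auto intro!: derivative_eq_intros)
  then show ?thesis
    by (rule has_vector_derivative_transform[OF x, rotated]) (rule u, simp)
qed

text \<open>A finite-dimensional complement spanned by \<open>e\<close> contradicts the existence of more than \<open>card S\<close>
  inhomogeneities \<open>h j\<close> no nontrivial combination of which admits a square-integrable solution.\<close>

theorem infinite_codimension:
  fixes e :: "'s \<Rightarrow> real \<Rightarrow> complex^3"
  assumes \<mu>: "\<mu> \<in> circle_eigenvalues (V T l)" and "finite S"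
    and span: "\<And>h. h \<in> L2 \<Longrightarrow> \<exists>u k c. (u, k) \<in> system_graph A l \<and> ae_eq h (\<lambda>x. k x + (\<Sum>s\<in>S. c s *s e s x))"
  shows False
proof -
  obtain w p q where w': "\<And>x. (w has_vector_derivative - (w x v* A x l)) (at x)"
    and w0: "\<And>x. w x \<noteq> 0" and p: "p > 0" and pq: "\<And>x. x \<ge> 0 \<Longrightarrow> p \<le> norm (w x) \<and> norm (w x) \<le> q"
    using bounded_adjoint_solution[OF \<mu>] by blast
  \<comment> \<open>The vector field \<open>z\<close> is normalized by \<open>w \<cdot> z = 1\<close>, so that \<open>w \<cdot> h j = \<psi> j\<close> on \<open>x \<ge> 0\<close>; and
    \<open>\<psi> j\<close> is the derivative of the power \<open>(1 + x)\<^sup>t\<close> with \<open>t = growth_exponent j\<close>.\<close>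
  define z where "z x = inverse ((norm (w x))\<^sup>2) *\<^sub>R (\<chi> i. cnj (w x $ i))" for x
  define \<psi> where "\<psi> j x = growth_exponent j * (1 + x) powr (growth_exponent j - 1)" for j x
  define h where "h j x = (indicator {0..} x * \<psi> j x) *\<^sub>R z x" for j x
  have norm_z: "norm (z x) = inverse (norm (w x))" for x
  proof -
    have "norm (\<chi> i. cnj (w x $ i)) = norm (w x)" by (simp add: norm_vec_def)
    then show ?thesis using w0[of x] by (simp add: z_def power2_eq_square)
  qed
  have cont_w: "continuous_on UNIV w"
    by (intro continuous_at_imp_continuous_on ballI has_vector_derivative_continuous[OF w'])
  have cont_z: "continuous_on UNIV z"
    unfolding z_def using w0
    by (intro continuous_on_scaleR continuous_on_inverse continuous_on_vec_lambda continuous_on_cnj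
        continuous_on_component continuous_on_power continuous_on_norm cont_w) simp
  have dot_h: "dot (w x) (h j x) = of_real (\<psi> j x)" if "x \<ge> 0" for j x
    using that w0[of x] by (simp add: h_def z_def dot.scaleR_right dot_cnj scaleR_conv_of_real[where 'a = complex])
  have h_L2: "h j \<in> L2" for j
  proof -
    have meas: "h j \<in> borel_measurable lborel"
    proof -
      have "z \<in> borel_measurable borel"
        using cont_z by (rule borel_measurable_continuous_onI)
      moreover have "(\<lambda>x. indicator {0..} x * \<psi> j x) \<in> borel_measurable borel"
        unfolding \<psi>_def by measurable
      ultimately show ?thesis
        unfolding h_def by (simp add: borel_measurable_scaleR)
    qed
    have "integrable lborel (\<lambda>x. inverse (p\<^sup>2) * (indicator {0..} x * (1 + x) powr - (2 - 2 * growth_exponent j)))"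
      using growth_exponent_bounds(2)[of j] by (intro integrable_mult_right integrable_power_decay) simp
    then have "integrable lborel (\<lambda>x. (norm (h j x))\<^sup>2)"
    proof (rule Bochner_Integration.integrable_bound)
      show "(\<lambda>x. (norm (h j x))\<^sup>2) \<in> borel_measurable lborel"
        using meas by measurable
      have "(norm (h j x))\<^sup>2 \<le> inverse (p\<^sup>2) * (indicator {0..} x * (1 + x) powr - (2 - 2 * growth_exponent j))" for x
      proof (cases "x \<ge> 0")
        case True
        have "(\<psi> j x)\<^sup>2 = (growth_exponent j)\<^sup>2 * (1 + x) powr - (2 - 2 * growth_exponent j)"
          using True by (simp add: \<psi>_def power_mult_distrib powr_power)
        also have "\<dots> \<le> 1 * (1 + x) powr - (2 - 2 * growth_exponent j)"
          using growth_exponent_bounds[of j] by (intro mult_right_mono power_le_one) auto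
        finally have "(\<psi> j x)\<^sup>2 \<le> (1 + x) powr - (2 - 2 * growth_exponent j)" by simp
        moreover have "(norm (z x))\<^sup>2 \<le> inverse (p\<^sup>2)"
          using pq[OF True] p by (simp add: norm_z power_mono le_imp_inverse_le flip: power_inverse)
        ultimately have "(norm (z x))\<^sup>2 * (\<psi> j x)\<^sup>2 \<le> inverse (p\<^sup>2) * (1 + x) powr - (2 - 2 * growth_exponent j)"
          by (intro mult_mono) simp_all
        then show ?thesis
          using True by (simp add: h_def power_mult_distrib mult.commute)
      qed (simp add: h_def)
      then show "AE x in lborel. norm ((norm (h j x))\<^sup>2)
          \<le> norm (inverse (p\<^sup>2) * (indicator {0..} x * (1 + x) powr - (2 - 2 * growth_exponent j)))"
        by (intro AE_I2) simp
    qed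
    with meas show ?thesis by (simp add: L2_def)
  qed
  have "\<forall>j. \<exists>u k c. (u, k) \<in> system_graph A l \<and> ae_eq (h j) (\<lambda>x. k x + (\<Sum>s\<in>S. c s *s e s x))"
    using span[OF h_L2] by simp
  then obtain U K C where UKC: "\<forall>j. (U j, K j) \<in> system_graph A l \<and>
      ae_eq (h j) (\<lambda>x. K j x + (\<Sum>s\<in>S. C j s *s e s x))"
    unfolding choice_iff by (elim exE) (rule that)
  then have UK: "\<And>j. (U j, K j) \<in> system_graph A l"
    and hK: "\<And>j. ae_eq (h j) (\<lambda>x. K j x + (\<Sum>s\<in>S. C j s *s e s x))"
    by simp_all
  \<comment> \<open>There are \<open>card S + 1\<close> inhomogeneities, so some combination has no component along \<open>e\<close>.\<close>
  obtain d where d: "\<exists>j\<in>{..card S}. d j \<noteq> 0" and rel: "\<And>s. s \<in> S \<Longrightarrow> (\<Sum>j\<le>card S. d j * C j s) = 0"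
    using nontrivial_relation[OF \<open>finite S\<close>, of "{..card S}" C] by auto
  define J where "J = {..card S}"
  define u where "u x = (\<Sum>j\<in>J. d j *s U j x)" for x
  define k where "k x = (\<Sum>j\<in>J. d j *s K j x)" for x
  define H where "H x = (\<Sum>j\<in>J. d j *s h j x)" for x
  have sol: "(u, k) \<in> system_graph A l"
    unfolding u_def k_def J_def by (intro system_graph_sum UK) simp
  have kH: "ae_eq k H"
  proof -
    have "AE x in lborel. \<forall>j\<in>J. h j x = K j x + (\<Sum>s\<in>S. C j s *s e s x)"
      using hK by (simp add: AE_finite_all ae_eq_def J_def)
    then show ?thesis
      unfolding ae_eq_def
    proof eventually_elim
      case (elim x)
      have "(\<Sum>j\<in>J. d j *s (\<Sum>s\<in>S. C j s *s e s x)) = (\<Sum>s\<in>S. (\<Sum>j\<in>J. d j * C j s) *s e s x)"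
        by (simp add: vec_eq_iff sum_distrib_left sum_distrib_right mult.assoc sum.swap[of _ J])
      also have "\<dots> = 0"
        using rel by (simp add: J_def)
      finally show "k x = H x"
        using elim by (simp add: k_def H_def vector_add_ldistrib sum.distrib)
    qed
  qed
  have cont_H: "continuous_on {0..X} H" for X
  proof -
    have "continuous_on {0..X} (\<lambda>x. d j *s (\<psi> j x *\<^sub>R z x))" for j
    proof -
      have "continuous_on {0..X} (\<psi> j)"
        unfolding \<psi>_def by (intro continuous_intros) auto
      moreover have "continuous_on {0..X} z"
        using cont_z by (rule continuous_on_subset) simp
      moreover have "continuous_on UNIV (\<lambda>v :: complex^3. d j *s v)"
        by (intro linear_continuous_on linear_conv_bounded_linear[THEN iffD1] linearI)
          (simp_all add: vec_eq_iff algebra_simps)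
      ultimately show ?thesis
        using continuous_on_compose2[of UNIV "\<lambda>v. d j *s v" "{0..X}" "\<lambda>x. \<psi> j x *\<^sub>R z x"]
        by (simp add: continuous_on_scaleR)
    qed
    then have "continuous_on {0..X} (\<lambda>x. \<Sum>j\<in>J. d j *s (\<psi> j x *\<^sub>R z x))"
      by (intro continuous_on_sum)
    moreover have "(\<Sum>j\<in>J. d j *s (\<psi> j x *\<^sub>R z x)) = H x" if "x \<in> {0..X}" for x
      using that by (simp add: H_def h_def)
    ultimately show ?thesis by (rule continuous_on_eq)
  qed
  define \<Psi> where "\<Psi> x = (\<Sum>j\<in>J. d j * of_real ((1 + x) powr growth_exponent j))" for x
  have dot_H: "dot (w x) (H x) = (\<Sum>j\<in>J. d j * of_real (\<psi> j x))" if "x \<ge> 0" for x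
    using that by (simp add: H_def dot.sum_right dot_smult dot_h)
  \<comment> \<open>The terms with \<open>A\<close> cancel in \<open>(w \<cdot> u)\<^sub>x\<close> because \<open>w\<close> solves the adjoint system.\<close>
  have const: "dot (w x) (u x) - \<Psi> x = dot (w 0) (u 0) - \<Psi> 0" if "x \<ge> 0" for x
  proof -
    have "((\<lambda>y. dot (w y) (u y) - \<Psi> y) has_vector_derivative 0) (at y within {0..x})" if y: "y \<in> {0..x}" for y
    proof -
      have deriv_pairing: "((\<lambda>y. dot (w y) (u y)) has_vector_derivative
          dot (w y) (A y l *v u y + H y) + dot (- (w y v* A y l)) (u y)) (at y within {0..x})"
        by (rule dot.has_vector_derivative[OF has_vector_derivative_at_within[OF w']
              solution_differentiable[OF sol kH cont_H y]])
      have cancel: "dot (w y) (A y l *v u y + H y) + dot (- (w y v* A y l)) (u y) = (\<Sum>j\<in>J. d j * of_real (\<psi> j y))"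
        using y by (simp add: dot.add_right dot.minus_left dot_row_mult dot_H)
      have deriv_\<Psi>: "(\<Psi> has_vector_derivative (\<Sum>j\<in>J. d j * of_real (\<psi> j y))) (at y within {0..x})"
        unfolding \<Psi>_def
      proof (intro has_vector_derivative_sum)
        fix j
        have "((\<lambda>x. (1 + x) powr growth_exponent j) has_vector_derivative \<psi> j y) (at y within {0..x})"
          unfolding has_real_derivative_iff_has_vector_derivative[symmetric] \<psi>_def
          using y by (auto intro!: derivative_eq_intros)
        note bounded_linear.has_vector_derivative[OF bounded_linear_of_real this, where 'a1 = complex]
        from bounded_linear.has_vector_derivative[OF bounded_linear_mult_right this, of "d j"]
        show "((\<lambda>x. d j * of_real ((1 + x) powr growth_exponent j)) has_vector_derivative
            d j * of_real (\<psi> j y)) (at y within {0..x})" .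
      qed
      from has_vector_derivative_diff[OF deriv_pairing[unfolded cancel] deriv_\<Psi>]
      show ?thesis by simp
    qed
    then obtain c where "\<And>y. y \<in> {0..x} \<Longrightarrow> dot (w y) (u y) - \<Psi> y = c"
      using has_vector_derivative_zero_constant[of "{0..x}" "\<lambda>y. dot (w y) (u y) - \<Psi> y"] convex_real_interval(5)
      by blast
    then show ?thesis using that by simp
  qed
  obtain \<epsilon> X where eps: "\<epsilon> > 0" "X \<ge> 0"
    and grow: "\<And>x. x \<ge> X \<Longrightarrow> \<epsilon> \<le> cmod ((dot (w 0) (u 0) - \<Psi> 0) + \<Psi> x)"
    using powers_combination_bounded_below[of J d] d unfolding \<Psi>_def J_def by blast
  obtain B where B: "B > 0" "\<And>a b. cmod (dot a b) \<le> norm a * norm b * B"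
    using dot.pos_bounded by blast
  have q: "q > 0" using p pq[of 0] by simp
  show False
  proof (rule not_L2_if_bounded_below)
    show "u \<in> L2" using sol by (simp add: system_graph_def)
    show "\<epsilon> / (q * B) > 0" using eps q B by simp
    show "\<epsilon> / (q * B) \<le> norm (u x)" if "x \<ge> X" for x
    proof -
      have x: "x \<ge> 0" using that eps by simp
      have "\<epsilon> \<le> cmod (dot (w x) (u x))"
        using grow[OF that] unfolding const[OF x, symmetric] by simp
      also have "\<dots> \<le> norm (w x) * norm (u x) * B" by (rule B(2))
      also have "\<dots> \<le> q * norm (u x) * B"
        using pq[OF x] B(1) by (intro mult_right_mono) auto
      finally show ?thesis
        using q B(1) by (simp add: field_simps)
    qed
  qed
qed

text \<open>If \<open>l - P\<close> were Fredholm, its range and hence the range of the system would have finite codimension.\<close>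

theorem circle_eigenvalue_imp_essential_spectrum:
  fixes P :: "(real \<Rightarrow> complex^'n) rel"
  assumes \<mu>: "\<mu> \<in> circle_eigenvalues (V T l)"
    and P: "P \<subseteq> L2 \<times> L2" and reform: "first_order_reformulation P A"
  shows "l \<in> essential_spectrum P"
proof (rule ccontr)
  assume "l \<notin> essential_spectrum P"
  then have "finite_dim_mod (L2_range (shifted_graph P l)) L2"
    by (simp add: essential_spectrum_def L2_fredholm_def)
  then show False
  proof (rule system_range_finite_codimension[OF P reform])
    fix S :: "(real \<Rightarrow> complex^'n) set" and e
    assume "finite S" and span: "\<And>h. h \<in> L2 \<Longrightarrow>
      \<exists>u k c. (u, k) \<in> system_graph A l \<and> ae_eq h (\<lambda>x. k x + (\<Sum>s\<in>S. c s *s e s x))"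
    show False by (rule infinite_codimension[OF \<mu> \<open>finite S\<close> span])
  qed
qed

end


section \<open>The stability criterion\<close>

theorem theorem2:
  fixes A V :: "real \<Rightarrow> complex \<Rightarrow> complex^3^3"
    and M :: "complex \<Rightarrow> complex^3^3"
    and f :: "complex \<Rightarrow> complex"
    and T :: real
    and J L :: "(real \<Rightarrow> complex^'m) rel"
    and lam :: complex
  assumes T_pos: "T > 0"
    and regular_periodic: "admissible_coefficients T A"
    and A1: "real_on_real_axis A"
    and A2: "hamiltonian_symmetry A"
    and trace_zero: "\<And>x l. trace (A x l) = 0"
    and V: "fundamental_solution A V"
    and M: "\<And>l. M l = V T l"
    and f: "\<And>l. f l = trace (M l)"
    and imaginary: "Re lam = 0"
  shows
    "circle_count (M lam) \<in> {1, 3} \<and>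
     complex_of_real (Delta3 (f lam)) =
       of_real (cmod (f lam) ^ 4) - 4 * f lam ^ 3 - 4 * cnj (f lam) ^ 3
         + 18 * of_real ((cmod (f lam))\<^sup>2) - 27 \<and>
     (Delta3 (f lam) < 0 \<longrightarrow>
       card (circle_eigenvalues (M lam)) = 3 \<and>
       (hamiltonian_problem T J L \<and> first_order_reformulation (L O J) A \<longrightarrow>
         essential_spectrum_with_mult (L O J) (M lam) lam 3)) \<and>
     (Delta3 (f lam) > 0 \<longrightarrow>
       (\<exists>\<mu>0 \<mu>1 \<mu>2. eigenvalues (M lam) = {\<mu>0, \<mu>1, \<mu>2} \<and>
          cmod \<mu>0 = 1 \<and> cmod \<mu>1 < 1 \<and> cmod \<mu>2 > 1 \<and> \<mu>1 \<noteq> 0 \<and> Arg \<mu>1 = Arg \<mu>2)) \<and>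
     (Delta3 (f lam) = 0 \<longrightarrow>
       circle_count (M lam) = 3 \<and>
       (\<exists>\<mu>\<in>circle_eigenvalues (M lam). alg_mult (M lam) \<mu> \<ge> 2)) \<and>
     (f lam \<in> connected_component_set (- deltoid) 0 \<longrightarrow>
       card (circle_eigenvalues (M lam)) = 3) \<and>
     (f lam \<in> outside deltoid \<longrightarrow>
       (\<exists>\<mu>0 \<mu>1 \<mu>2. eigenvalues (M lam) = {\<mu>0, \<mu>1, \<mu>2} \<and>
          cmod \<mu>0 = 1 \<and> cmod \<mu>1 < 1 \<and> cmod \<mu>2 > 1)) \<and>
     (f lam \<in> deltoid \<longrightarrow>
       circle_count (M lam) = 3 \<and>
       (\<exists>\<mu>\<in>circle_eigenvalues (M lam). alg_mult (M lam) \<mu> \<ge> 2) \<and>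
       (f lam \<notin> {3, 3 * cis (2 * pi / 3), 3 * cis (4 * pi / 3)} \<longrightarrow>
          (\<exists>\<mu>\<in>circle_eigenvalues (M lam). \<exists>\<nu>\<in>circle_eigenvalues (M lam).
             alg_mult (M lam) \<mu> = 1 \<and> alg_mult (M lam) \<nu> = 2)) \<and>
       (\<forall>\<omega>\<in>{1, cis (2 * pi / 3), cis (4 * pi / 3)}.
          f lam = 3 * \<omega> \<longrightarrow> \<omega> \<in> eigenvalues (M lam) \<and> alg_mult (M lam) \<omega> = 3))"
proof -
  interpret hamiltonian_system T A V
    by unfold_locales (fact T_pos regular_periodic A1 A2 trace_zero V)+
  define F where "F = f lam"
  define N where "N = M lam"
  have cp: "char_polynomial N = reciprocal_cubic F"
    using char_polynomial_monodromy[OF imaginary] by (simp add: N_def F_def M f)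
  have below: "card (circle_eigenvalues N) = 3" "\<forall>\<mu>\<in>circle_eigenvalues N. alg_mult N \<mu> = 1"
    if neg: "Delta3 F < 0"
  proof -
    obtain a b c where fac: "reciprocal_cubic F = monic_roots a b c"
      and unit: "cmod a = 1" "cmod b = 1" "cmod c = 1"
      and "Delta3 F < 0 \<longleftrightarrow> a \<noteq> b \<and> b \<noteq> c \<and> c \<noteq> a"
      using less_imp_le[OF neg] by (rule Delta3_nonpos_imp_circle)
    with neg have distinct: "a \<noteq> b" "b \<noteq> c" "c \<noteq> a" by blast+
    note circle = circle_spectrum(1)[OF cp[unfolded fac] unit]
    from distinct show "card (circle_eigenvalues N) = 3"
      by (simp add: circle)
    from distinct show "\<forall>\<mu>\<in>circle_eigenvalues N. alg_mult N \<mu> = 1"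
      by (auto simp: circle spectrum_from_factorization(2)[OF cp[unfolded fac]])
  qed
  have essential: "essential_spectrum_with_mult (L O J) N lam 3"
    if "Delta3 F < 0" "hamiltonian_problem T J L" "first_order_reformulation (L O J) A"
  proof -
    have "circle_eigenvalues N \<noteq> {}" using below[OF that(1)] by auto
    then obtain \<mu> where "\<mu> \<in> circle_eigenvalues (V T lam)" by (auto simp: N_def M)
    from circle_eigenvalue_imp_essential_spectrum[OF this hamiltonian_problem_subset_L2[OF that(2)] that(3)]
    show ?thesis
      using below[OF that(1)] by (simp add: essential_spectrum_with_mult_def)
  qed
  have above: "\<exists>\<mu>0 \<mu>1 \<mu>2. eigenvalues N = {\<mu>0, \<mu>1, \<mu>2} \<and> cmod \<mu>0 = 1 \<and> cmod \<mu>1 < 1 \<and> cmod \<mu>2 > 1 \<and>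
      \<mu>1 \<noteq> 0 \<and> Arg \<mu>1 = Arg \<mu>2" if pos: "Delta3 F > 0"
  proof -
    obtain a c where fac: "reciprocal_cubic F = monic_roots a (inverse (cnj a)) c"
      and a: "a \<noteq> 0" "cmod a < 1" and c: "cmod c = 1"
      using pos by (rule Delta3_pos_imp_off_circle)
    note off = off_circle_spectrum[OF cp[unfolded fac] a c]
    show ?thesis
      by (rule exI[of _ c], rule exI[of _ a], rule exI[of _ "inverse (cnj a)"])
        (intro conjI off a c)
  qed
  have count: "circle_count N \<in> {1, 3}"
  proof (cases "Delta3 F > 0")
    case True
    then obtain a c where fac: "reciprocal_cubic F = monic_roots a (inverse (cnj a)) c"
      and a: "a \<noteq> 0" "cmod a < 1" and c: "cmod c = 1"
      by (rule Delta3_pos_imp_off_circle)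
    from off_circle_spectrum(2)[OF cp[unfolded fac] a c] show ?thesis by simp
  next
    case False
    then obtain a b c where fac: "reciprocal_cubic F = monic_roots a b c"
      and unit: "cmod a = 1" "cmod b = 1" "cmod c = 1"
      using Delta3_nonpos_imp_circle[of F, OF leI[OF False]] by metis
    from circle_spectrum(2)[OF cp[unfolded fac] unit] show ?thesis by simp
  qed
  have zero: "circle_count N = 3 \<and> (\<exists>\<mu>\<in>circle_eigenvalues N. alg_mult N \<mu> \<ge> 2) \<and>
      (F \<notin> {3, 3 * cis (2 * pi / 3), 3 * cis (4 * pi / 3)} \<longrightarrow>
        (\<exists>\<mu>\<in>circle_eigenvalues N. \<exists>\<nu>\<in>circle_eigenvalues N. alg_mult N \<mu> = 1 \<and> alg_mult N \<nu> = 2))"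
    if null: "Delta3 F = 0"
  proof -
    obtain a c where fac: "reciprocal_cubic F = monic_roots a a c" and unit: "cmod a = 1" "cmod c = 1"
      using null by (rule Delta3_zero_imp_double_root)
    note mult = spectrum_from_factorization(2)[OF cp[unfolded fac]]
    note circle = circle_spectrum[OF cp[unfolded fac] unit(1) unit]
    have cusp: "a \<noteq> c" if "F \<notin> {3, 3 * cis (2 * pi / 3), 3 * cis (4 * pi / 3)}"
    proof
      assume "a = c"
      then have "F = 3 * a" "a ^ 3 = 1" using fac[unfolded vieta] by (auto simp: power3_eq_cube)
      with that cube_root_of_unity[of a] show False by auto
    qed
    show ?thesis
    proof (intro conjI impI)
      show "circle_count N = 3" by (rule circle(2))
      show "\<exists>\<mu>\<in>circle_eigenvalues N. alg_mult N \<mu> \<ge> 2"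
        by (intro bexI[of _ a]) (simp_all add: mult circle(1))
      show "\<exists>\<mu>\<in>circle_eigenvalues N. \<exists>\<nu>\<in>circle_eigenvalues N. alg_mult N \<mu> = 1 \<and> alg_mult N \<nu> = 2"
        if "F \<notin> {3, 3 * cis (2 * pi / 3), 3 * cis (4 * pi / 3)}"
        using cusp[OF that] by (intro bexI[of _ c] bexI[of _ a]) (simp_all add: mult circle(1))
    qed
  qed
  have triple: "\<omega> \<in> eigenvalues N \<and> alg_mult N \<omega> = 3"
    if "\<omega> \<in> {1, cis (2 * pi / 3), cis (4 * pi / 3)}" "F = 3 * \<omega>" for \<omega>
  proof -
    have \<omega>: "\<omega> ^ 3 = 1" "cmod \<omega> = 1" using that(1) cube_root_of_unity[of \<omega>] by auto
    have "inverse \<omega> = \<omega> * \<omega>"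
      using \<omega>(1) by (intro inverse_unique) (simp add: power3_eq_cube mult.assoc)
    then have "reciprocal_cubic F = monic_roots \<omega> \<omega> \<omega>"
      unfolding vieta that(2) using \<omega> by (simp add: cnj_unit power3_eq_cube)
    note spectrum_from_factorization[OF cp[unfolded this]]
    then show ?thesis by simp
  qed
  have "circle_count N \<in> {1, 3} \<and>
     complex_of_real (Delta3 F) =
       of_real (cmod F ^ 4) - 4 * F ^ 3 - 4 * cnj F ^ 3 + 18 * of_real ((cmod F)\<^sup>2) - 27 \<and>
     (Delta3 F < 0 \<longrightarrow> card (circle_eigenvalues N) = 3 \<and>
       (hamiltonian_problem T J L \<and> first_order_reformulation (L O J) A \<longrightarrow>
         essential_spectrum_with_mult (L O J) N lam 3)) \<and>
     (Delta3 F > 0 \<longrightarrow>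
       (\<exists>\<mu>0 \<mu>1 \<mu>2. eigenvalues N = {\<mu>0, \<mu>1, \<mu>2} \<and>
          cmod \<mu>0 = 1 \<and> cmod \<mu>1 < 1 \<and> cmod \<mu>2 > 1 \<and> \<mu>1 \<noteq> 0 \<and> Arg \<mu>1 = Arg \<mu>2)) \<and>
     (Delta3 F = 0 \<longrightarrow>
       circle_count N = 3 \<and> (\<exists>\<mu>\<in>circle_eigenvalues N. alg_mult N \<mu> \<ge> 2)) \<and>
     (F \<in> connected_component_set (- deltoid) 0 \<longrightarrow> card (circle_eigenvalues N) = 3) \<and>
     (F \<in> outside deltoid \<longrightarrow>
       (\<exists>\<mu>0 \<mu>1 \<mu>2. eigenvalues N = {\<mu>0, \<mu>1, \<mu>2} \<and>
          cmod \<mu>0 = 1 \<and> cmod \<mu>1 < 1 \<and> cmod \<mu>2 > 1)) \<and>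
     (F \<in> deltoid \<longrightarrow>
       circle_count N = 3 \<and> (\<exists>\<mu>\<in>circle_eigenvalues N. alg_mult N \<mu> \<ge> 2) \<and>
       (F \<notin> {3, 3 * cis (2 * pi / 3), 3 * cis (4 * pi / 3)} \<longrightarrow>
          (\<exists>\<mu>\<in>circle_eigenvalues N. \<exists>\<nu>\<in>circle_eigenvalues N.
             alg_mult N \<mu> = 1 \<and> alg_mult N \<nu> = 2)) \<and>
       (\<forall>\<omega>\<in>{1, cis (2 * pi / 3), cis (4 * pi / 3)}.
          F = 3 * \<omega> \<longrightarrow> \<omega> \<in> eigenvalues N \<and> alg_mult N \<omega> = 3))"
  proof (intro conjI impI ballI)
    show "circle_count N \<in> {1, 3}" by (rule count)
    show "complex_of_real (Delta3 F) =
       of_real (cmod F ^ 4) - 4 * F ^ 3 - 4 * cnj F ^ 3 + 18 * of_real ((cmod F)\<^sup>2) - 27"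
      by (rule Delta3_complex)
  next
    assume "F \<in> outside deltoid"
    from above[OF Delta3_outside_deltoid[OF this]]
    show "\<exists>\<mu>0 \<mu>1 \<mu>2. eigenvalues N = {\<mu>0, \<mu>1, \<mu>2} \<and> cmod \<mu>0 = 1 \<and> cmod \<mu>1 < 1 \<and> cmod \<mu>2 > 1"
      by (elim exE conjE) (intro exI conjI)
  qed (use below essential above zero triple Delta3_inside_deltoid deltoid_iff_Delta3 in \<open>simp_all\<close>)
  then show ?thesis unfolding F_def N_def .
qed

end
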